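(* Let $G$ be an $n$-node $\phi$-expander graph with minimum degree $\Theta(t^2\log n/\phi)$. There exists a randomized broadcast algorithm in the adversarial \textsc{CONGEST} model against $t$ adversarial edges with round complexity $O(t\cdot \log^2 n/\phi)$.
   Context: For $S\subseteq V$, $\delta_G(S)$ is the number of edges between $S$ and $V\setminus S$, $vol_G(S)$ is the number of edges incident to $S$, and (when both $S$ and $V\setminus S$ have positive volume) the conductance is $\phi_G(S)=\delta_G(S)/\min\{vol_G(S),vol_G(V\setminus S)\}$; $\phi(G)=\min_{S\subset V}\phi_G(S)$, and $G$ is a $\phi$-expander if $\phi(G)\ge\phi$. Adversarial CONGEST model: the network is an $n$-node graph $G=(V,E)$ with a processor at each node; nodes have unique $O(\log n)$-bit identifiers; initially each node knows only the identifiers of its incident edges and a polynomial estimate of $n$. Synchronous rounds; each node may send an $O(\log n)$-bit message per incident edge per round. A computationally unbounded, adaptive adversary, knowing the topology, the protocol and all random coins, controls a fixed unknown set $F$ of at most $t$ edges and may send arbitrary $O(\log n)$-bit messages over them (possibly different per direction) based on all communication so far; nodes know $t$. Broadcast task: a source $s$ holds a message $m_0$ and all nodes must output $m_0$, ignoring other messages. *)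

theory Defs
  imports "HOL-Probability.Product_PMF"
begin

section \<open>Graphs and conductance\<close>

text \<open>
  Vertices are identified with their unique identifiers, which are natural numbers, and an
  edge with the set of its two endpoints.
\<close>

type_synonym node = nat
type_synonym edge = "node set"

definition simple_graph :: "node set \<Rightarrow> edge set \<Rightarrow> bool" where
  "simple_graph V E \<longleftrightarrow> finite V \<and> E \<subseteq> {e. e \<subseteq> V \<and> card e = 2}"

definition incident :: "edge set \<Rightarrow> node \<Rightarrow> edge set" where
  "incident E v = {e \<in> E. v \<in> e}"

definition min_degree :: "node set \<Rightarrow> edge set \<Rightarrow> nat" where
  "min_degree V E = Min ((\<lambda>v. card (incident E v)) ` V)"

definition cut_size :: "node set \<Rightarrow> edge set \<Rightarrow> node set \<Rightarrow> nat" where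
  "cut_size V E S = card {e \<in> E. e \<inter> S \<noteq> {} \<and> e \<inter> (V - S) \<noteq> {}}"

text \<open>
  The volume is the number of edges touching \<open>S\<close>, not the sum of the degrees: an edge inside
  \<open>S\<close> counts once.
\<close>

definition vol :: "edge set \<Rightarrow> node set \<Rightarrow> nat" where
  "vol E S = card {e \<in> E. e \<inter> S \<noteq> {}}"

definition cut_conductance :: "node set \<Rightarrow> edge set \<Rightarrow> node set \<Rightarrow> real" where
  "cut_conductance V E S =
     real (cut_size V E S) / real (min (vol E S) (vol E (V - S)))"

text \<open>
  \<open>Min\<close> is meaningful only if some cut has positive volume on both sides; this is the case as
  soon as there are two vertices and the minimum degree is positive.
\<close>

definition graph_conductance :: "node set \<Rightarrow> edge set \<Rightarrow> real" where
  "graph_conductance V E =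
     Min (cut_conductance V E ` {S. S \<subset> V \<and> 0 < vol E S \<and> 0 < vol E (V - S)})"

definition expander :: "real \<Rightarrow> node set \<Rightarrow> edge set \<Rightarrow> bool" where
  "expander \<phi> V E \<longleftrightarrow> \<phi> \<le> graph_conductance V E"


section \<open>Randomized CONGEST protocols\<close>

type_synonym msg = "bool list"

text \<open>What is put on an edge, in one direction and one round; \<open>None\<close> is silence.\<close>

type_synonym slot = "msg option"

definition fits :: "real \<Rightarrow> slot \<Rightarrow> bool" where
  "fits B x \<longleftrightarrow> (\<forall>m. x = Some m \<longrightarrow> real (length m) \<le> B)"

record knowledge =
  own_id :: node
  ports :: "edge set"
  size_estimate :: nat
  fault_bound :: nat
  source_input :: "msg option"

text \<open>
  Local computation is unrestricted, so the local state of a node is represented by its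
  complete history: the list, round by round, of what arrived over each incident edge.
\<close>

type_synonym history = "(edge \<Rightarrow> slot) list"

record protocol =
  num_coins :: "knowledge \<Rightarrow> nat"
  send :: "knowledge \<Rightarrow> bool list \<Rightarrow> history \<Rightarrow> edge \<Rightarrow> slot"
  decide :: "knowledge \<Rightarrow> bool list \<Rightarrow> history \<Rightarrow> msg option"

type_synonym coins = "node \<Rightarrow> bool list"

definition initial_knowledge ::
    "edge set \<Rightarrow> nat \<Rightarrow> nat \<Rightarrow> node \<Rightarrow> msg \<Rightarrow> node \<Rightarrow> knowledge" where
  "initial_knowledge E N t s m0 v =
     \<lparr>own_id = v, ports = incident E v, size_estimate = N, fault_bound = t,
      source_input = (if v = s then Some m0 else None)\<rparr>"

definition coin_pmf :: "protocol \<Rightarrow> (node \<Rightarrow> knowledge) \<Rightarrow> node set \<Rightarrow> coins pmf" where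
  "coin_pmf A I V =
     Pi_pmf V [] (\<lambda>v. pmf_of_set {xs. length xs = num_coins A (I v)})"


section \<open>Executions with adversarial edges\<close>

text \<open>
  One entry per round: \<open>fst\<close> gives what each node sent, \<open>snd\<close> what each node received.
\<close>

type_synonym transcript = "((node \<Rightarrow> edge \<Rightarrow> slot) \<times> (node \<Rightarrow> edge \<Rightarrow> slot)) list"

text \<open>
  Both components may depend on all the random coins. The controlled edge set does not change
  during an execution. \<open>inject \<omega> tr v e\<close> is what \<open>v\<close> receives over a controlled edge \<open>e\<close>
  in the round following the rounds in \<open>tr\<close>, so the two directions of \<open>e\<close> are independent.
\<close>

record adversary =
  controlled :: "coins \<Rightarrow> edge set"
  inject :: "coins \<Rightarrow> transcript \<Rightarrow> node \<Rightarrow> edge \<Rightarrow> slot"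

definition admissible :: "edge set \<Rightarrow> nat \<Rightarrow> real \<Rightarrow> adversary \<Rightarrow> bool" where
  "admissible E t B adv \<longleftrightarrow>
     (\<forall>\<omega>. controlled adv \<omega> \<subseteq> E \<and> card (controlled adv \<omega>) \<le> t) \<and>
     (\<forall>\<omega> tr v e. fits B (inject adv \<omega> tr v e))"

definition local_history :: "transcript \<Rightarrow> node \<Rightarrow> history" where
  "local_history tr v = map (\<lambda>r. snd r v) tr"

text \<open>
  The output of a node is the first value produced by \<open>decide\<close>; from then on the node is
  silent.
\<close>

definition halted ::
    "protocol \<Rightarrow> (node \<Rightarrow> knowledge) \<Rightarrow> coins \<Rightarrow> transcript \<Rightarrow> node \<Rightarrow> bool" where
  "halted A I \<omega> tr v \<longleftrightarrow>
     (\<exists>k\<le>length tr. decide A (I v) (\<omega> v) (local_history (take k tr) v) \<noteq> None)"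

definition outputs_at ::
    "protocol \<Rightarrow> (node \<Rightarrow> knowledge) \<Rightarrow> coins \<Rightarrow> transcript \<Rightarrow> node \<Rightarrow> msg \<Rightarrow> bool" where
  "outputs_at A I \<omega> tr v m \<longleftrightarrow>
     decide A (I v) (\<omega> v) (local_history tr v) = Some m \<and>
     (\<forall>k<length tr. decide A (I v) (\<omega> v) (local_history (take k tr) v) = None)"

definition sent ::
    "protocol \<Rightarrow> edge set \<Rightarrow> (node \<Rightarrow> knowledge) \<Rightarrow> coins \<Rightarrow> transcript \<Rightarrow> node \<Rightarrow> edge \<Rightarrow> slot" where
  "sent A E I \<omega> tr v e =
     (if e \<in> incident E v \<and> \<not> halted A I \<omega> tr v
      then send A (I v) (\<omega> v) (local_history tr v) e else None)"

definition received ::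
    "protocol \<Rightarrow> adversary \<Rightarrow> edge set \<Rightarrow> (node \<Rightarrow> knowledge) \<Rightarrow> coins \<Rightarrow> transcript
      \<Rightarrow> node \<Rightarrow> edge \<Rightarrow> slot" where
  "received A adv E I \<omega> tr v e =
     (if e \<notin> incident E v then None
      else if e \<in> controlled adv \<omega> then inject adv \<omega> tr v e
      else sent A E I \<omega> tr (the_elem (e - {v})) e)"

primrec run ::
    "protocol \<Rightarrow> adversary \<Rightarrow> edge set \<Rightarrow> (node \<Rightarrow> knowledge) \<Rightarrow> coins \<Rightarrow> nat \<Rightarrow> transcript" where
  "run A adv E I \<omega> 0 = []"
| "run A adv E I \<omega> (Suc r) =
     (let tr = run A adv E I \<omega> r
      in tr @ [(sent A E I \<omega> tr, received A adv E I \<omega> tr)])"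


section \<open>Broadcast\<close>

definition respects_bandwidth ::
    "protocol \<Rightarrow> adversary \<Rightarrow> edge set \<Rightarrow> (node \<Rightarrow> knowledge) \<Rightarrow> node set \<Rightarrow> real \<Rightarrow> bool" where
  "respects_bandwidth A adv E I V B \<longleftrightarrow>
     (\<forall>\<omega>\<in>set_pmf (coin_pmf A I V). \<forall>r. \<forall>v\<in>V. \<forall>e\<in>incident E v.
        fits B (sent A E I \<omega> (run A adv E I \<omega> r) v e))"

definition broadcast_done ::
    "protocol \<Rightarrow> adversary \<Rightarrow> edge set \<Rightarrow> (node \<Rightarrow> knowledge) \<Rightarrow> node set \<Rightarrow> msg \<Rightarrow> real
      \<Rightarrow> coins \<Rightarrow> bool" where
  "broadcast_done A adv E I V m0 T \<omega> \<longleftrightarrow>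
     (\<forall>v\<in>V. \<exists>r. real r \<le> T \<and> outputs_at A I \<omega> (run A adv E I \<omega> r) v m0)"

text \<open>
  \<open>B\<close> is the number of bits per message, \<open>T\<close> the number of rounds and \<open>p\<close> the success
  probability.
\<close>

definition solves_broadcast ::
    "protocol \<Rightarrow> node set \<Rightarrow> edge set \<Rightarrow> nat \<Rightarrow> nat \<Rightarrow> node \<Rightarrow> msg \<Rightarrow> real \<Rightarrow> real \<Rightarrow> real \<Rightarrow> bool" where
  "solves_broadcast A V E N t s m0 B T p \<longleftrightarrow>
     (\<forall>adv. admissible E t B adv \<longrightarrow>
        (let I = initial_knowledge E N t s m0 in
           respects_bandwidth A adv E I V B \<and>
           measure_pmf.prob (coin_pmf A I V) {\<omega>. broadcast_done A adv E I V m0 T \<omega>} \<ge> p))"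

end

theory Submission
  imports Defs
begin

text \<open>
  With \<open>L\<close> of order \<open>t * log n\<close>, run \<open>L\<close> floods in parallel, round \<open>r\<close> serving flood
  \<open>r mod L\<close>. In each flood every node listens only to a random subset of its ports, each port
  being chosen with probability about \<open>1 / (32 * t)\<close>; a node accepts a message heard in more
  than half of the floods. A fixed set of \<open>t\<close> edges is listened to in half of the floods with
  probability at most \<open>2 ^ (- L)\<close>, which survives a union bound over all sets of \<open>t\<close> edges and
  so tolerates an adversary who chooses the set after seeing the coins. The floods that listen
  to no controlled edge carry only the true message. In every flood the sampled arcs still
  expand: from any reached set \<open>S\<close>, the nodes that hear something next have degree sum more than
  half of the cut of \<open>S\<close>. Hence \<open>O(log n / \<phi>)\<close> steps of a flood reach all nodes. The nodes
  need not know \<open>\<phi>\<close>, because each of them stops on its own after accepting.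
\<close>

section \<open>Parallel floods\<close>

definition heard :: "nat \<Rightarrow> (nat \<Rightarrow> edge set) \<Rightarrow> nat \<Rightarrow> history \<Rightarrow> msg set" where
  "heard L R i h = {m. \<exists>j<length h. j mod L = i \<and> (\<exists>e\<in>R i. (h ! j) e = Some m)}"

definition voted :: "nat \<Rightarrow> (nat \<Rightarrow> edge set) \<Rightarrow> history \<Rightarrow> msg \<Rightarrow> bool" where
  "voted L R h m \<longleftrightarrow> L < 2 * card {i. i < L \<and> m \<in> heard L R i h}"

text \<open>Several messages can win the vote, since a corrupted flood may deliver more than one.
  The arbitrary choice by \<open>SOME\<close> becomes harmless when most floods are good: then only
  \<open>m0\<close> can win.\<close>

definition accepted :: "msg option \<Rightarrow> nat \<Rightarrow> (nat \<Rightarrow> edge set) \<Rightarrow> history \<Rightarrow> msg option" where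
  "accepted src L R h =
     (if src \<noteq> None then src
      else if \<exists>m. voted L R h m then Some (SOME m. voted L R h m) else None)"

definition flood_send :: "msg option \<Rightarrow> nat \<Rightarrow> (nat \<Rightarrow> edge set) \<Rightarrow> history \<Rightarrow> slot" where
  "flood_send src L R h =
     (if accepted src L R h \<noteq> None then accepted src L R h
      else if heard L R (length h mod L) h \<noteq> {}
      then Some (SOME m. m \<in> heard L R (length h mod L) h) else None)"

text \<open>
  A halted node is silent, so a node keeps sending for \<open>L\<close> rounds after accepting: this
  serves every flood once, which is all its neighbours need.
\<close>

definition flood_decide :: "msg option \<Rightarrow> nat \<Rightarrow> (nat \<Rightarrow> edge set) \<Rightarrow> history \<Rightarrow> msg option" where
  "flood_decide src L R h =
     (if length h < L then None else accepted src L R (take (length h - L) h))"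

text \<open>Sampling is directed: an edge carries the flood towards \<open>v\<close> only if
  \<open>v\<close> itself listens to it, so its two directions are sampled separately.\<close>

definition flood_step :: "edge set \<Rightarrow> (node \<Rightarrow> edge set) \<Rightarrow> node set \<Rightarrow> node set" where
  "flood_step E Q S = S \<union> {v. \<exists>u\<in>S. {u, v} \<in> E \<and> {u, v} \<in> Q v}"

section \<open>Prefixes of executions\<close>

lemma length_run [simp]: "length (run A adv E I \<omega> r) = r"
  by (induction r) (simp_all add: Let_def)

lemma take_run: "k \<le> r \<Longrightarrow> take k (run A adv E I \<omega> r) = run A adv E I \<omega> k"
proof (induction r)
  case (Suc r)
  then show ?case by (cases "k = Suc r") (simp_all add: Let_def)
qed simp

lemma nth_run:
  assumes "j < r"
  shows "run A adv E I \<omega> r ! j =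
    (sent A E I \<omega> (run A adv E I \<omega> j), received A adv E I \<omega> (run A adv E I \<omega> j))"
proof -
  have "run A adv E I \<omega> r ! j = take (Suc j) (run A adv E I \<omega> r) ! j"
    by simp
  also have "take (Suc j) (run A adv E I \<omega> r) = run A adv E I \<omega> (Suc j)"
    using assms by (intro take_run) simp
  finally show ?thesis by (simp add: Let_def nth_append)
qed

text \<open>Meant for the \<open>L\<close> rounds between acceptance and halting: in this window a
  node serves every flood.\<close>

lemma ex_residue_in_window:
  fixes k L i :: nat
  assumes "i < L"
  shows "\<exists>j. k \<le> j \<and> j < k + L \<and> j mod L = i"
proof (cases "k mod L \<le> i")
  case True
  have "(k + (i - k mod L)) mod L = (k mod L + (i - k mod L)) mod L"
    by (simp add: mod_add_left_eq)
  with True assms show ?thesis by (intro exI[of _ "k + (i - k mod L)"]) auto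
next
  case False
  have "k mod L < L" using assms by simp
  have "(k + (i + L - k mod L)) mod L = (k mod L + (i + L - k mod L)) mod L"
    by (simp add: mod_add_left_eq)
  also have "\<dots> = (i + L) mod L" using \<open>k mod L < L\<close> by simp
  finally show ?thesis using False assms \<open>k mod L < L\<close>
    by (intro exI[of _ "k + (i + L - k mod L)"]) auto
qed

section \<open>Executions for fixed coins: acceptance, halting and message length\<close>

locale flooding =
  fixes V :: "node set" and E :: "edge set" and s :: node and m0 :: msg and L :: nat
    and R :: "node \<Rightarrow> nat \<Rightarrow> edge set" and A :: protocol and I :: "node \<Rightarrow> knowledge"
    and \<omega> :: coins and adv :: adversary
  assumes graph: "simple_graph V E"
    and L_pos: "L > 0"
    and send_eq: "\<And>v h e. v \<in> V \<Longrightarrow>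
      send A (I v) (\<omega> v) h e = flood_send (source_input (I v)) L (R v) h"
    and decide_eq: "\<And>v h. v \<in> V \<Longrightarrow>
      decide A (I v) (\<omega> v) h = flood_decide (source_input (I v)) L (R v) h"
    and source_eq: "\<And>v. v \<in> V \<Longrightarrow> source_input (I v) = (if v = s then Some m0 else None)"
begin

abbreviation tr :: "nat \<Rightarrow> transcript" where
  "tr r \<equiv> run A adv E I \<omega> r"

definition heard_by :: "nat \<Rightarrow> nat \<Rightarrow> node \<Rightarrow> msg set" where
  "heard_by i r v = heard L (R v) i (local_history (tr r) v)"

definition acc :: "nat \<Rightarrow> node \<Rightarrow> msg option" where
  "acc r v = accepted (source_input (I v)) L (R v) (local_history (tr r) v)"

lemma heard_by_iff:
  "m \<in> heard_by i r v \<longleftrightarrow>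
    (\<exists>j<r. j mod L = i \<and> (\<exists>e\<in>R v i. received A adv E I \<omega> (tr j) v e = Some m))"
proof -
  have "(local_history (tr r) v ! j) e = received A adv E I \<omega> (tr j) v e" if "j < r" for j e
    using that by (simp add: local_history_def nth_run)
  moreover have "length (local_history (tr r) v) = r" by (simp add: local_history_def)
  ultimately show ?thesis unfolding heard_by_def heard_def mem_Collect_eq by metis
qed

lemma heard_by_mono: "r \<le> r' \<Longrightarrow> heard_by i r v \<subseteq> heard_by i r' v"
  unfolding subset_iff heard_by_iff using less_le_trans by blast

lemma voted_iff:
  "voted L (R v) (local_history (tr r) v) m \<longleftrightarrow> L < 2 * card {i. i < L \<and> m \<in> heard_by i r v}"
  by (simp add: voted_def heard_by_def)

lemma voted_mono:
  assumes "r \<le> r'" and "voted L (R v) (local_history (tr r) v) m"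
  shows "voted L (R v) (local_history (tr r') v) m"
proof -
  have "card {i. i < L \<and> m \<in> heard_by i r v} \<le> card {i. i < L \<and> m \<in> heard_by i r' v}"
    using heard_by_mono[OF assms(1)] by (intro card_mono) auto
  with assms(2) show ?thesis by (simp add: voted_iff)
qed

text \<open>Votes only accumulate. Nothing is claimed about the accepted value, because further
  messages may win the vote later and change the result of \<open>SOME\<close>.\<close>

lemma acc_mono: "r \<le> r' \<Longrightarrow> acc r v \<noteq> None \<Longrightarrow> acc r' v \<noteq> None"
  using voted_mono[of r r' v] unfolding acc_def accepted_def by (auto split: if_splits)

lemma acc_source: "s \<in> V \<Longrightarrow> acc r s = Some m0"
  by (simp add: acc_def accepted_def source_eq)

lemma acc_voted:
  assumes "v \<in> V" "acc r v = Some m" "v \<noteq> s"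
  shows "voted L (R v) (local_history (tr r) v) m"
  using assms by (auto simp: acc_def accepted_def source_eq split: if_splits intro: someI)

lemma decide_run:
  assumes "v \<in> V"
  shows "decide A (I v) (\<omega> v) (local_history (tr r) v) = (if r < L then None else acc (r - L) v)"
proof -
  have "take (r - L) (local_history (tr r) v) = local_history (tr (r - L)) v"
    by (simp add: local_history_def take_map take_run)
  then show ?thesis using assms
    by (simp add: decide_eq flood_decide_def acc_def) (simp add: local_history_def)
qed

text \<open>By \<open>acc_mono\<close>, having decided at some earlier round amounts to having
  accepted by round \<open>r - L\<close>, so a single round needs to be tested.\<close>

lemma halted_iff:
  assumes "v \<in> V"
  shows "halted A I \<omega> (tr r) v \<longleftrightarrow> L \<le> r \<and> acc (r - L) v \<noteq> None"
proof -
  have "halted A I \<omega> (tr r) v \<longleftrightarrow> (\<exists>k\<le>r. (if k < L then None else acc (k - L) v) \<noteq> None)"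
    unfolding halted_def length_run
    by (rule ex_cong1) (auto simp: take_run decide_run assms)
  also have "\<dots> \<longleftrightarrow> L \<le> r \<and> acc (r - L) v \<noteq> None" (is "?lhs = ?rhs")
  proof
    assume ?rhs
    then show ?lhs by (intro exI[of _ r]) auto
  next
    assume "\<exists>k\<le>r. (if k < L then None else acc (k - L) v) \<noteq> None"
    then obtain k where "k \<le> r" "L \<le> k" "acc (k - L) v \<noteq> None" by (auto split: if_splits)
    then show "L \<le> r \<and> acc (r - L) v \<noteq> None"
      using acc_mono[of "k - L" "r - L" v] by auto
  qed
  finally show ?thesis .
qed

lemma sent_eq:
  assumes "v \<in> V" "e \<in> incident E v"
  shows "sent A E I \<omega> (tr r) v e =
    (if L \<le> r \<and> acc (r - L) v \<noteq> None then None
     else if acc r v \<noteq> None then acc r v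
     else if heard_by (r mod L) r v \<noteq> {} then Some (SOME m. m \<in> heard_by (r mod L) r v)
     else None)"
  using assms
  by (simp add: sent_def halted_iff send_eq flood_send_def acc_def heard_by_def)
     (simp add: local_history_def)

lemma neighbour:
  assumes "e \<in> incident E v"
  shows "\<exists>u\<in>V. e = {u, v} \<and> u \<noteq> v \<and> the_elem (e - {v}) = u \<and> e \<in> incident E u \<and> v \<in> V"
proof -
  have e: "e \<in> E" "v \<in> e" using assms by (auto simp: incident_def)
  then have "card e = 2" "e \<subseteq> V" using graph by (auto simp: simple_graph_def)
  then obtain x y where "e = {x, y}" "x \<noteq> y" by (meson card_2_iff)
  then obtain u where u: "e = {u, v}" "u \<noteq> v" using e(2) by auto
  then have "e - {v} = {u}" by auto
  then show ?thesis using u e \<open>e \<subseteq> V\<close> by (auto simp: incident_def)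
qed

text \<open>Nodes compose nothing new: each message in transit is \<open>m0\<close>, was injected by
  the adversary, or repeats something received earlier. Strong induction over the rounds carries the
  bound \<open>B\<close> along.\<close>

lemma received_fits:
  assumes B: "real (length m0) \<le> B" and adm: "\<And>tr v e. fits B (inject adv \<omega> tr v e)"
  shows "fits B (received A adv E I \<omega> (tr r) v e)"
    and "v \<in> V \<Longrightarrow> e \<in> incident E v \<Longrightarrow> fits B (sent A E I \<omega> (tr r) v e)"
proof -
  have *: "(\<forall>v e. fits B (received A adv E I \<omega> (tr r) v e)) \<and>
        (\<forall>v\<in>V. \<forall>e\<in>incident E v. fits B (sent A E I \<omega> (tr r) v e))" for r
  proof (induction r rule: less_induct)
    case (less r)
    have heard: "real (length m) \<le> B" if "m \<in> heard_by i r v" for m i v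
      using that less by (auto simp: heard_by_iff fits_def)
    have accd: "real (length m) \<le> B" if m: "acc r v = Some m" and v: "v \<in> V" for m v
    proof (cases "v = s")
      case True
      then show ?thesis using acc_source m v B by simp
    next
      case False
      then have "L < 2 * card {i. i < L \<and> m \<in> heard_by i r v}"
        using acc_voted[OF v m] by (simp add: voted_iff)
      then have "{i. i < L \<and> m \<in> heard_by i r v} \<noteq> {}" by (intro notI) simp
      then show ?thesis using heard by blast
    qed
    have sent: "fits B (sent A E I \<omega> (tr r) v e)" if "v \<in> V" "e \<in> incident E v" for v e
    proof -
      have "real (length m) \<le> B" if "sent A E I \<omega> (tr r) v e = Some m" for m
      proof (cases "acc r v = Some m")
        case True
        then show ?thesis using accd \<open>v \<in> V\<close> by blast
      next
        case False
        then have "heard_by (r mod L) r v \<noteq> {}" "m = (SOME m. m \<in> heard_by (r mod L) r v)"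
          using that unfolding sent_eq[OF \<open>v \<in> V\<close> \<open>e \<in> incident E v\<close>]
          by (simp_all split: if_splits)
        then have "m \<in> heard_by (r mod L) r v" by (simp add: some_in_eq)
        then show ?thesis by (rule heard)
      qed
      then show ?thesis by (simp add: fits_def)
    qed
    moreover have "fits B (received A adv E I \<omega> (tr r) v e)" for v e
      using adm sent neighbour[of e v] by (auto simp: received_def fits_def)
    ultimately show ?case by blast
  qed
  show "fits B (received A adv E I \<omega> (tr r) v e)" using * by blast
  show "v \<in> V \<Longrightarrow> e \<in> incident E v \<Longrightarrow> fits B (sent A E I \<omega> (tr r) v e)" using * by blast
qed

definition good :: "nat \<Rightarrow> bool" where
  "good i \<longleftrightarrow> (\<forall>v\<in>V. \<forall>e\<in>controlled adv \<omega>. e \<in> incident E v \<longrightarrow> e \<notin> R v i)"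

end

section \<open>Soundness and progress when most floods avoid the controlled edges\<close>

locale flooding_good = flooding +
  assumes few_bad: "2 * card {i. i < L \<and> \<not> good i} < L"
begin

lemma many_good: "L < 2 * card {i. i < L \<and> good i}"
proof -
  have "{i. i < L \<and> good i} = {..<L} - {i. i < L \<and> \<not> good i}" by auto
  then have "card {i. i < L \<and> good i} = L - card {i. i < L \<and> \<not> good i}"
    by (simp add: card_Diff_subset subset_eq)
  with few_bad show ?thesis by simp
qed

text \<open>A wrong message can be heard only in floods that are not good, and these are too few for
  a majority. What the good floods carry is a premise here, because \<open>heard_sound\<close> uses
  this fact inside its own induction.\<close>

lemma acc_sound:
  assumes "v \<in> V" "\<And>i. i < L \<Longrightarrow> good i \<Longrightarrow> heard_by i r v \<subseteq> {m0}"
  shows "acc r v \<in> {None, Some m0}"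
proof (rule ccontr)
  assume "acc r v \<notin> {None, Some m0}"
  then obtain m where m: "acc r v = Some m" "m \<noteq> m0" by auto
  have "v \<noteq> s" using m acc_source assms(1) by auto
  then have "L < 2 * card {i. i < L \<and> m \<in> heard_by i r v}"
    using acc_voted[OF assms(1) m(1)] by (simp add: voted_iff)
  also have "card {i. i < L \<and> m \<in> heard_by i r v} \<le> card {i. i < L \<and> \<not> good i}"
    using assms(2) m(2) by (intro card_mono) auto
  finally show False using few_bad by simp
qed

text \<open>Floods are not isolated from each other, since a node that has accepted sends its value
  in all of them. The induction over the rounds therefore treats all good floods together and
  controls accepted values through \<open>acc_sound\<close>.\<close>

lemma heard_sound:
  assumes "i < L" "good i"
  shows "heard_by i r v \<subseteq> {m0}"
  using assms
proof (induction r arbitrary: v i rule: less_induct)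
  case (less r)
  show ?case
  proof
    fix m assume "m \<in> heard_by i r v"
    then obtain j e where j: "j < r" "j mod L = i" "e \<in> R v i"
      "received A adv E I \<omega> (tr j) v e = Some m"
      by (auto simp: heard_by_iff)
    have inc: "e \<in> incident E v" using j(4) by (auto simp: received_def split: if_splits)
    then obtain u where u: "u \<in> V" "the_elem (e - {v}) = u" "e \<in> incident E u" "v \<in> V"
      using neighbour by blast
    have "e \<notin> controlled adv \<omega>" using less.prems(2) j(3) inc u(4) by (auto simp: good_def)
    then have sent: "sent A E I \<omega> (tr j) u e = Some m" using j(4) inc u(2) by (simp add: received_def)
    have "acc j u \<in> {None, Some m0}"
      using less.IH[OF j(1)] u(1) by (intro acc_sound)
    moreover have "heard_by i j u \<subseteq> {m0}" using less.IH[OF j(1)] less.prems by blast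
    ultimately show "m \<in> {m0}" using sent u(1,3) j(2)
      by (auto simp: sent_eq split: if_splits intro: someI2)
  qed
qed

lemma acc_cases: "v \<in> V \<Longrightarrow> acc r v = None \<or> acc r v = Some m0"
  using acc_sound[of v r] heard_sound by auto

text \<open>Each block of \<open>L\<close> rounds simulates at least one \<open>flood_step\<close>
  in every good flood. The source is a separate case because it need not hear anything.\<close>

lemma heard_reach:
  assumes i: "i < L" "good i" and s: "s \<in> V"
  shows "v \<in> (flood_step E (\<lambda>v. R v i) ^^ k) {s} \<Longrightarrow> v = s \<or> v \<in> V \<and> m0 \<in> heard_by i (L * k) v"
proof (induction k arbitrary: v)
  case 0
  then show ?case by simp
next
  case (Suc k)
  let ?S = "(flood_step E (\<lambda>v. R v i) ^^ k) {s}"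
  show ?case
  proof (cases "v \<in> ?S")
    case True
    then show ?thesis
      using Suc.IH[of v] heard_by_mono[of "L * k" "L * Suc k" i v] by auto
  next
    case False
    with Suc.prems obtain u where u: "u \<in> ?S" "{u, v} \<in> E" "{u, v} \<in> R v i"
      unfolding funpow.simps o_apply flood_step_def[of _ _ "(flood_step _ _ ^^ _) _"] by blast
    let ?e = "{u, v}"
    have inc: "?e \<in> incident E v" "?e \<in> incident E u" using u by (auto simp: incident_def)
    have uv: "u \<in> V" "v \<in> V" "u \<noteq> v"
      using graph u(2) by (auto simp: simple_graph_def)
    then have "?e - {v} = {u}" by auto
    then have the: "the_elem (?e - {v}) = u" by simp
    have clean: "?e \<notin> controlled adv \<omega>" using i(2) u(3) inc uv by (auto simp: good_def)
    have "\<exists>j<L * Suc k. j mod L = i \<and> sent A E I \<omega> (tr j) u ?e = Some m0"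
    \<comment> \<open>An active \<open>u\<close> sends in the round of block \<open>k\<close> that
      serves flood \<open>i\<close>. A halted \<open>u\<close> must have sent earlier, which is
      enough because hearing is cumulative.\<close>
    proof (cases "halted A I \<omega> (tr (L * k + i)) u")
      case False
      have j: "(L * k + i) mod L = i" using i by simp
      have "acc (L * k + i) u = Some m0 \<or>
          (acc (L * k + i) u = None \<and> m0 \<in> heard_by i (L * k + i) u)"
        using acc_cases[OF uv(1)] Suc.IH[OF u(1)] acc_source[OF s]
          heard_by_mono[of "L * k" "L * k + i" i u] by fastforce
      moreover have "heard_by i (L * k + i) u \<subseteq> {m0}" by (rule heard_sound[OF i])
      ultimately have "sent A E I \<omega> (tr (L * k + i)) u ?e = Some m0"
        using False j unfolding halted_iff[OF uv(1)] sent_eq[OF uv(1) inc(2)]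
        by (auto intro!: some_equality)
      then show ?thesis using i j by (intro exI[of _ "L * k + i"]) auto
    next
      case True
      then have h: "L \<le> L * k + i" "acc (L * k + i - L) u \<noteq> None"
        by (simp_all add: halted_iff[OF uv(1)])
      \<comment> \<open>From its first acceptance at \<open>q\<close> until just before round
        \<open>q + L\<close> the node \<open>u\<close> is not yet silent, so the round of this
        window that serves flood \<open>i\<close> is used. As \<open>u\<close> has halted by round
        \<open>L * k + i\<close>, the window ends within the first \<open>k + 1\<close>
        blocks.\<close>
      define q where "q = (LEAST q. acc q u \<noteq> None)"
      have q: "acc q u \<noteq> None" "q \<le> L * k + i - L"
        unfolding q_def using h(2) by (auto intro: LeastI Least_le)
      have least: "acc q' u = None" if "q' < q" for q'
        using that not_less_Least unfolding q_def by blast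
      obtain j where j: "q \<le> j" "j < q + L" "j mod L = i"
        using ex_residue_in_window[OF i(1)] by blast
      have "acc j u = Some m0" using acc_mono[OF j(1) q(1)] acc_cases[OF uv(1), of j] by auto
      moreover have "\<not> (L \<le> j \<and> acc (j - L) u \<noteq> None)" using least[of "j - L"] j(2) by auto
      ultimately have "sent A E I \<omega> (tr j) u ?e = Some m0"
        using sent_eq[OF uv(1) inc(2)] by auto
      moreover have "j < L * Suc k" using j(2) q(2) h(1) i(1) by simp
      ultimately show ?thesis using j(3) by blast
    qed
    then obtain j where "j < L * Suc k" "j mod L = i" "sent A E I \<omega> (tr j) u ?e = Some m0"
      by blast
    then have "m0 \<in> heard_by i (L * Suc k) v"
      unfolding heard_by_iff using u(3) inc clean the
      by (intro exI[of _ j] conjI bexI[of _ ?e]) (auto simp: received_def)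
    then show ?thesis using uv by blast
  qed
qed

text \<open>All nodes accept within \<open>L * D\<close> rounds, and each outputs exactly
  \<open>L\<close> rounds after its first acceptance; hence \<open>Suc D\<close>.\<close>

lemma broadcast_done_reach:
  assumes s: "s \<in> V" and T: "real (L * Suc D) \<le> T"
    and reach: "\<And>i. i < L \<Longrightarrow> V \<subseteq> (flood_step E (\<lambda>v. R v i) ^^ D) {s}"
  shows "broadcast_done A adv E I V m0 T \<omega>"
  unfolding broadcast_done_def
proof
  fix v assume v: "v \<in> V"
  have ex: "acc (L * D) v \<noteq> None"
  proof (cases "v = s")
    case True
    then show ?thesis using acc_source s by simp
  next
    case False
    then have "{i. i < L \<and> good i} \<subseteq> {i. i < L \<and> m0 \<in> heard_by i (L * D) v}"
      using heard_reach[OF _ _ s, of _ v D] reach v by blast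
    then have "card {i. i < L \<and> good i} \<le> card {i. i < L \<and> m0 \<in> heard_by i (L * D) v}"
      by (intro card_mono) auto
    then have "voted L (R v) (local_history (tr (L * D)) v) m0"
      using many_good by (simp add: voted_iff)
    then show ?thesis by (auto simp: acc_def accepted_def)
  qed
  define q where "q = (LEAST q. acc q v \<noteq> None)"
  have q: "acc q v \<noteq> None" "q \<le> L * D"
    unfolding q_def using ex by (auto intro: LeastI Least_le)
  have least: "acc q' v = None" if "q' < q" for q'
    using that not_less_Least unfolding q_def by blast
  have "outputs_at A I \<omega> (tr (q + L)) v m0"
    unfolding outputs_at_def
    using q(1) acc_cases[OF v, of q] least by (auto simp: decide_run v take_run)
  moreover have "real (q + L) \<le> T" using q(2) T
    by (intro order_trans[OF _ T] of_nat_mono) simp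
  ultimately show "\<exists>r. real r \<le> T \<and> outputs_at A I \<omega> (tr r) v m0" by blast
qed

end

section \<open>Random listening\<close>

lemma simple_graphD:
  assumes "simple_graph V E"
  shows "finite V" "finite E" "\<And>e. e \<in> E \<Longrightarrow> e \<subseteq> V" "\<And>e. e \<in> E \<Longrightarrow> card e = 2"
  using assms finite_subset[of E "Pow V"] by (auto simp: simple_graph_def)

text \<open>
  Any bijection between the coin sequences and the tables \<open>X \<rightarrow> {..<2 ^ k}\<close> turns uniform
  coins into independent uniform table entries.
\<close>

definition coin_table :: "nat \<Rightarrow> 'a set \<Rightarrow> bool list \<Rightarrow> 'a \<Rightarrow> nat" where
  "coin_table k X =
     (SOME g. bij_betw g {xs. length xs = k * card X} (PiE_dflt X 0 (\<lambda>_. {..<2 ^ k})))"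

lemma bool_lists_length:
  "finite {xs :: bool list. length xs = n}" "card {xs :: bool list. length xs = n} = 2 ^ n"
  using card_lists_length_eq[of "UNIV :: bool set" n] finite_lists_length_eq[of "UNIV :: bool set" n]
  by simp_all

lemma bij_betw_coin_table:
  assumes "finite X"
  shows "bij_betw (coin_table k X) {xs. length xs = k * card X} (PiE_dflt X 0 (\<lambda>_. {..<2 ^ k}))"
proof -
  have "card {xs :: bool list. length xs = k * card X} = card (PiE_dflt X (0::nat) (\<lambda>_. {..<2 ^ k}))"
    using assms by (simp add: card_PiE_dflt bool_lists_length power_mult)
  then have "\<exists>g. bij_betw g {xs :: bool list. length xs = k * card X} (PiE_dflt X (0::nat) (\<lambda>_. {..<2 ^ k}))"
    using assms by (intro finite_same_card_bij bool_lists_length finite_PiE_dflt) auto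
  then show ?thesis unfolding coin_table_def by (rule someI_ex)
qed

lemma map_pmf_coin_table:
  assumes "finite X"
  shows "map_pmf (coin_table k X) (pmf_of_set {xs. length xs = k * card X}) =
    Pi_pmf X 0 (\<lambda>_. pmf_of_set {..<2 ^ k})"
proof -
  have "replicate (k * card X) True \<in> {xs. length xs = k * card X}" by simp
  then have "map_pmf (coin_table k X) (pmf_of_set {xs. length xs = k * card X}) =
      pmf_of_set (PiE_dflt X 0 (\<lambda>_. {..<2 ^ k}))"
    by (intro map_pmf_of_set_bij_betw bij_betw_coin_table assms bool_lists_length) blast
  also have "\<dots> = Pi_pmf X 0 (\<lambda>_. pmf_of_set {..<2 ^ k})"
    using assms by (intro Pi_pmf_of_set[symmetric]) (auto simp: lessThan_empty_iff)
  finally show ?thesis .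
qed

text \<open>Entries outside \<open>Y\<close> are left free and contribute factors 1. With a general
  \<open>B\<close>, one statement covers both listening and not listening.\<close>

lemma prob_coin_table:
  assumes "finite X" "Y \<subseteq> X"
  shows "measure_pmf.prob (pmf_of_set {xs. length xs = k * card X})
      {xs. \<forall>y\<in>Y. coin_table k X xs y \<in> B} = (real (card ({..<2 ^ k} \<inter> B)) / 2 ^ k) ^ card Y"
proof -
  let ?q = "real (card ({..<2 ^ k} \<inter> B)) / 2 ^ k"
  let ?U = "pmf_of_set {..<2 ^ k::nat}"
  have q: "measure_pmf.prob ?U B = ?q"
    by (subst measure_pmf_of_set) (auto simp: lessThan_empty_iff)
  have "{xs. \<forall>y\<in>Y. coin_table k X xs y \<in> B} =
      coin_table k X -` Pi X (\<lambda>y. if y \<in> Y then B else UNIV)"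
    using assms(2) by (auto simp: Pi_def)
  then have "measure_pmf.prob (pmf_of_set {xs. length xs = k * card X})
      {xs. \<forall>y\<in>Y. coin_table k X xs y \<in> B} =
    measure_pmf.prob (Pi_pmf X 0 (\<lambda>_. ?U)) (Pi X (\<lambda>y. if y \<in> Y then B else UNIV))"
    using map_pmf_coin_table[OF assms(1), of k, symmetric] by (simp add: measure_map_pmf)
  also have "\<dots> = (\<Prod>y\<in>X. measure_pmf.prob ?U (if y \<in> Y then B else UNIV))"
    by (rule measure_Pi_pmf_Pi[OF assms(1)])
  also have "\<dots> = (\<Prod>y\<in>X. if y \<in> Y then ?q else 1)"
    by (intro prod.cong refl) (simp add: q)
  also have "\<dots> = (\<Prod>y\<in>{y\<in>X. y \<in> Y}. ?q)"
    by (rule prod.inter_filter[OF assms(1), symmetric])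
  also have "\<dots> = ?q ^ card {y\<in>X. y \<in> Y}" by simp
  also have "{y\<in>X. y \<in> Y} = Y" using assms(2) by auto
  finally show ?thesis .
qed

text \<open>Each node draws its own table; the fibres of \<open>Z\<close> over the nodes give
  independent events, and the exponents add up to \<open>card Z\<close>.\<close>

lemma prob_coin_tables:
  assumes "finite V" "\<And>v. v \<in> V \<Longrightarrow> finite (X v)" "Z \<subseteq> Sigma V X"
  shows "measure_pmf.prob (Pi_pmf V [] (\<lambda>v. pmf_of_set {xs. length xs = k * card (X v)}))
      {\<omega>. \<forall>(v, y)\<in>Z. coin_table k (X v) (\<omega> v) y \<in> B} =
    (real (card ({..<2 ^ k} \<inter> B)) / 2 ^ k) ^ card Z"
proof -
  let ?q = "real (card ({..<2 ^ k} \<inter> B)) / 2 ^ k"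
  have "{\<omega>. \<forall>(v, y)\<in>Z. coin_table k (X v) (\<omega> v) y \<in> B} =
      Pi V (\<lambda>v. {xs. \<forall>y\<in>Z `` {v}. coin_table k (X v) xs y \<in> B})"
    using assms(3) by (auto simp: Pi_def)
  then have "measure_pmf.prob (Pi_pmf V [] (\<lambda>v. pmf_of_set {xs. length xs = k * card (X v)}))
      {\<omega>. \<forall>(v, y)\<in>Z. coin_table k (X v) (\<omega> v) y \<in> B} =
    (\<Prod>v\<in>V. measure_pmf.prob (pmf_of_set {xs. length xs = k * card (X v)})
      {xs. \<forall>y\<in>Z `` {v}. coin_table k (X v) xs y \<in> B})"
    by (simp only: measure_Pi_pmf_Pi[OF assms(1)])
  also have "\<dots> = (\<Prod>v\<in>V. ?q ^ card (Z `` {v}))"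
    using assms by (intro prod.cong refl prob_coin_table) auto
  also have "\<dots> = ?q ^ (\<Sum>v\<in>V. card (Z `` {v}))" by (simp add: power_sum)
  also have "(\<Sum>v\<in>V. card (Z `` {v})) = card (SIGMA v:V. Z `` {v})"
    using assms by (intro card_SigmaI[symmetric] ballI) (auto intro: finite_subset[of _ "X _"])
  also have "(SIGMA v:V. Z `` {v}) = Z" using assms(3) by auto
  finally show ?thesis .
qed

section \<open>Union bounds over controlled edges and corrupted floods\<close>

lemma card_bounded_subsets_le:
  assumes "finite X"
  shows "card {F. F \<subseteq> X \<and> card F \<le> t} \<le> (card X + 1) ^ t"
proof -
  let ?Y = "insert None (Some ` X)"
  \<comment> \<open>A set of at most \<open>t\<close> elements is coded by a list of length exactly
    \<open>t\<close>, padded with \<open>None\<close>; this explains the base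
    \<open>card X + 1\<close>.\<close>
  let ?Ls = "{xs. set xs \<subseteq> ?Y \<and> length xs = t}"
  have "{F. F \<subseteq> X \<and> card F \<le> t} \<subseteq> (\<lambda>xs. {x. Some x \<in> set xs}) ` ?Ls"
  proof
    fix F assume "F \<in> {F. F \<subseteq> X \<and> card F \<le> t}"
    then have F: "F \<subseteq> X" "card F \<le> t" by auto
    then obtain ys where ys: "set ys = F" "distinct ys"
      using finite_distinct_list finite_subset[OF F(1) assms] by blast
    let ?xs = "map Some ys @ replicate (t - card F) None"
    have "?xs \<in> ?Ls" using F ys distinct_card[OF ys(2)] by auto
    moreover have "F = {x. Some x \<in> set ?xs}" using ys(1) by auto
    ultimately show "F \<in> (\<lambda>xs. {x. Some x \<in> set xs}) ` ?Ls" by blast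
  qed
  moreover have fin: "finite ?Ls" using assms by (intro finite_lists_length_eq) simp
  ultimately have "card {F. F \<subseteq> X \<and> card F \<le> t} \<le> card ?Ls"
    by (meson card_image_le card_mono finite_imageI le_trans)
  also have "\<dots> = card ?Y ^ t" using assms by (intro card_lists_length_eq) simp
  also have "card ?Y = card X + 1" using assms by (simp add: card_image image_iff)
  finally show ?thesis .
qed

text \<open>Independence of the listening choices enters through two product formulas: for a set of
  arcs that are all chosen, which bounds corruption, and for one with none chosen, which bounds slow
  expansion.\<close>

locale arc_sampling =
  fixes M :: "'w pmf" and V :: "node set" and E :: "edge set" and L :: nat and p :: real
    and hit :: "'w \<Rightarrow> node \<Rightarrow> nat \<Rightarrow> edge \<Rightarrow> bool"
  assumes graph: "simple_graph V E"
    and p_nonneg: "0 \<le> p" and p_le_1: "p \<le> 1"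
    and prob_all_hit: "\<And>Z. Z \<subseteq> (SIGMA v:V. {..<L} \<times> incident E v) \<Longrightarrow>
      measure_pmf.prob M {w. \<forall>(v, i, e)\<in>Z. hit w v i e} = p ^ card Z"
    and prob_none_hit: "\<And>Z. Z \<subseteq> (SIGMA v:V. {..<L} \<times> incident E v) \<Longrightarrow>
      measure_pmf.prob M {w. \<forall>(v, i, e)\<in>Z. \<not> hit w v i e} = (1 - p) ^ card Z"
begin

lemmas graphD = simple_graphD[OF graph]

text \<open>For each flood in \<open>J\<close>, pick a controlled arc that is listened to. There are
  at most \<open>2 * t\<close> such arcs, two per edge, and a fixed choice function has probability
  \<open>p ^ card J\<close>.\<close>

lemma prob_all_floods_corrupted:
  assumes J: "J \<subseteq> {..<L}" and F: "F \<subseteq> E" "card F \<le> t"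
  shows "measure_pmf.prob M {w. \<forall>i\<in>J. \<exists>v\<in>V. \<exists>e\<in>F. e \<in> incident E v \<and> hit w v i e}
    \<le> (2 * real t * p) ^ card J"
proof -
  let ?A = "(\<lambda>(e, v). (v, e)) ` (SIGMA e:F. e)"
  let ?Z = "\<lambda>f. (\<lambda>i. (fst (f i), i, snd (f i))) ` J"
  have finJ: "finite J" and finF: "finite F" using J F graphD(2) by (auto intro: finite_subset)
  have fine: "finite e" if "e \<in> F" for e
    using that F graphD(3,4)[of e] by (intro card_ge_0_finite) auto
  have "card ?A \<le> card (SIGMA e:F. e)" by (intro card_image_le) (use finF fine in auto)
  also have "\<dots> = (\<Sum>e\<in>F. card e)" using finF fine by simp
  also have "\<dots> = (\<Sum>e\<in>F. 2)" using F graphD(3,4) by (intro sum.cong) auto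
  finally have cardA: "card ?A \<le> 2 * t" using F(2) by simp
  have finA: "finite ?A" using finF fine by auto
  have "{w. \<forall>i\<in>J. \<exists>v\<in>V. \<exists>e\<in>F. e \<in> incident E v \<and> hit w v i e} \<subseteq>
      (\<Union>f\<in>PiE J (\<lambda>_. ?A). {w. \<forall>(v, i, e)\<in>?Z f. hit w v i e})"
  proof
    fix w assume "w \<in> {w. \<forall>i\<in>J. \<exists>v\<in>V. \<exists>e\<in>F. e \<in> incident E v \<and> hit w v i e}"
    then have "\<forall>i\<in>J. \<exists>a. a \<in> ?A \<and> hit w (fst a) i (snd a)"
      by (fastforce simp: incident_def)
    then obtain g where g: "\<forall>i\<in>J. g i \<in> ?A \<and> hit w (fst (g i)) i (snd (g i))"
      by metis
    show "w \<in> (\<Union>f\<in>PiE J (\<lambda>_. ?A). {w. \<forall>(v, i, e)\<in>?Z f. hit w v i e})"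
      using g by (intro UN_I[of "restrict g J"]) auto
  qed
  then have "measure_pmf.prob M {w. \<forall>i\<in>J. \<exists>v\<in>V. \<exists>e\<in>F. e \<in> incident E v \<and> hit w v i e} \<le>
      measure_pmf.prob M (\<Union>f\<in>PiE J (\<lambda>_. ?A). {w. \<forall>(v, i, e)\<in>?Z f. hit w v i e})"
    by (intro measure_pmf.finite_measure_mono) auto
  also have "\<dots> \<le> (\<Sum>f\<in>PiE J (\<lambda>_. ?A). measure_pmf.prob M {w. \<forall>(v, i, e)\<in>?Z f. hit w v i e})"
    using finJ finA by (intro measure_UNION_le finite_PiE) auto
  also have "\<dots> = (\<Sum>f\<in>PiE J (\<lambda>_. ?A). p ^ card J)"
  proof (intro sum.cong refl)
    fix f assume f: "f \<in> PiE J (\<lambda>_. ?A)"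
    have "?Z f \<subseteq> (SIGMA v:V. {..<L} \<times> incident E v)"
      using f J F graphD(3,4) by (fastforce simp: PiE_iff incident_def)
    moreover have "card (?Z f) = card J" by (intro card_image inj_onI) simp
    ultimately show "measure_pmf.prob M {w. \<forall>(v, i, e)\<in>?Z f. hit w v i e} = p ^ card J"
      using prob_all_hit[of "?Z f"] by simp
  qed
  also have "\<dots> = (real (card ?A) * p) ^ card J"
    using finJ by (simp add: card_PiE power_mult_distrib)
  also have "\<dots> \<le> (2 * real t * p) ^ card J"
    using cardA p_nonneg
    by (intro power_mono mult_right_mono) (simp_all add: order_trans[OF of_nat_mono[OF cardA]])
  finally show ?thesis .
qed

text \<open>The union runs over all \<open>F\<close>, since the adversary sees the coins before
  picking its edges, and over all sets \<open>J\<close> of at least half of the floods.\<close>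

lemma prob_many_floods_corrupted:
  assumes p: "2 * real t * p \<le> 1 / 16"
  shows "measure_pmf.prob M
      {w. \<exists>F\<subseteq>E. card F \<le> t \<and>
        L \<le> 2 * card {i. i < L \<and> (\<exists>v\<in>V. \<exists>e\<in>F. e \<in> incident E v \<and> hit w v i e)}}
    \<le> real ((card E + 1) ^ t) * (1 / 2) ^ L"
proof -
  let ?bad = "\<lambda>w F i. \<exists>v\<in>V. \<exists>e\<in>F. e \<in> incident E v \<and> hit w v i e"
  let ?FF = "{F. F \<subseteq> E \<and> card F \<le> t}"
  let ?JJ = "{J. J \<subseteq> {..<L} \<and> L \<le> 2 * card J}"
  let ?B = "\<lambda>(F, J). {w. \<forall>i\<in>J. ?bad w F i}"
  have finF: "finite ?FF" using graphD(2) by simp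
  have finJ: "finite ?JJ" by simp
  have "{w. \<exists>F\<subseteq>E. card F \<le> t \<and> L \<le> 2 * card {i. i < L \<and> ?bad w F i}} \<subseteq> (\<Union>x\<in>?FF \<times> ?JJ. ?B x)"
  proof
    fix w assume "w \<in> {w. \<exists>F\<subseteq>E. card F \<le> t \<and> L \<le> 2 * card {i. i < L \<and> ?bad w F i}}"
    then obtain F where "F \<in> ?FF" "L \<le> 2 * card {i. i < L \<and> ?bad w F i}" by auto
    then show "w \<in> (\<Union>x\<in>?FF \<times> ?JJ. ?B x)"
      by (intro UN_I[of "(F, {i. i < L \<and> ?bad w F i})"]) auto
  qed
  then have "measure_pmf.prob M
      {w. \<exists>F\<subseteq>E. card F \<le> t \<and> L \<le> 2 * card {i. i < L \<and> ?bad w F i}} \<le>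
      measure_pmf.prob M (\<Union>x\<in>?FF \<times> ?JJ. ?B x)"
    by (intro measure_pmf.finite_measure_mono) auto
  also have "\<dots> \<le> (\<Sum>x\<in>?FF \<times> ?JJ. measure_pmf.prob M (?B x))"
    using finF finJ by (intro measure_UNION_le) auto
  also have "\<dots> \<le> (\<Sum>x\<in>?FF \<times> ?JJ. (1 / 4) ^ L)"
  proof (intro sum_mono)
    fix x assume "x \<in> ?FF \<times> ?JJ"
    then obtain F J where x: "x = (F, J)" and F: "F \<subseteq> E" "card F \<le> t"
      and J: "J \<subseteq> {..<L}" "L \<le> 2 * card J" by auto
    have "measure_pmf.prob M (?B x) \<le> (2 * real t * p) ^ card J"
      using prob_all_floods_corrupted[OF J(1) F] x by simp
    \<comment> \<open>As \<open>J\<close> contains at least half of the floods, 1/16 yields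
      \<open>(1 / 4) ^ L\<close>. The at most \<open>2 ^ L\<close> sets \<open>J\<close> then leave
      \<open>(1 / 2) ^ L\<close>.\<close>
    also have "\<dots> \<le> (1 / 16) ^ card J" using p p_nonneg by (intro power_mono) auto
    also have "\<dots> = (1 / 4) ^ (2 * card J)" by (simp add: power_mult power2_eq_square)
    also have "\<dots> \<le> (1 / 4) ^ L" using J(2) by (intro power_decreasing) auto
    finally show "measure_pmf.prob M (?B x) \<le> (1 / 4) ^ L" .
  qed
  also have "\<dots> = real (card ?FF) * (real (card ?JJ) * (1 / 4) ^ L)"
    by (simp add: card_cartesian_product)
  also have "\<dots> \<le> real ((card E + 1) ^ t) * (2 ^ L * (1 / 4) ^ L)"
  proof -
    have "card ?JJ \<le> card (Pow {..<L})" by (intro card_mono) auto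
    then have "real (card ?JJ) \<le> 2 ^ L"
      by (metis card_Pow card_lessThan finite_lessThan of_nat_le_iff of_nat_numeral of_nat_power)
    then show ?thesis
      using card_bounded_subsets_le[OF graphD(2), of t]
      by (intro mult_mono mult_right_mono) (simp_all only: of_nat_le_iff, simp_all)
  qed
  also have "(2::real) ^ L * (1 / 4) ^ L = (1 / 2) ^ L" by (simp flip: power_mult_distrib)
  finally show ?thesis .
qed

end

section \<open>Expansion of the sampled arcs\<close>

text \<open>Unlike \<open>vol\<close>, which counts an inner edge once, this quantity is additive
  over disjoint sets, as the growth argument requires. It is at most twice
  \<open>vol\<close>.\<close>

definition degree_sum :: "edge set \<Rightarrow> node set \<Rightarrow> nat" where
  "degree_sum E S = (\<Sum>v\<in>S. card (incident E v))"

lemma finite_incident: "finite E \<Longrightarrow> finite (incident E v)"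
  by (simp add: incident_def)

lemma degree_sum_Un_disjoint:
  "finite S \<Longrightarrow> finite S' \<Longrightarrow> S \<inter> S' = {} \<Longrightarrow> degree_sum E (S \<union> S') = degree_sum E S + degree_sum E S'"
  by (simp add: degree_sum_def sum.union_disjoint)

lemma degree_sum_mono: "finite S' \<Longrightarrow> S \<subseteq> S' \<Longrightarrow> degree_sum E S \<le> degree_sum E S'"
  unfolding degree_sum_def by (intro sum_mono2) auto

lemma degree_sum_le_vol:
  assumes "simple_graph V E" "S \<subseteq> V"
  shows "degree_sum E S \<le> 2 * vol E S"
proof -
  note g = simple_graphD[OF assms(1)]
  have fin: "finite S" using g(1) assms(2) finite_subset by blast
  have "degree_sum E S = (\<Sum>v\<in>S. \<Sum>e\<in>E. if v \<in> e then 1 else 0)"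
    unfolding degree_sum_def incident_def using g(2) by (simp add: sum.If_cases Int_def)
  also have "\<dots> = (\<Sum>e\<in>E. \<Sum>v\<in>S. if v \<in> e then 1 else 0)" by (rule sum.swap)
  also have "\<dots> = (\<Sum>e\<in>E. card (e \<inter> S))"
    using fin by (simp add: sum.If_cases Int_def conj_commute)
  also have "\<dots> \<le> (\<Sum>e\<in>E. if e \<inter> S \<noteq> {} then 2 else 0)"
  proof (intro sum_mono)
    fix e assume "e \<in> E"
    then have "finite e" "card e = 2" using g by (auto intro: card_ge_0_finite)
    then show "card (e \<inter> S) \<le> (if e \<inter> S \<noteq> {} then 2 else 0)"
      using card_mono[of e "e \<inter> S"] by auto
  qed
  also have "\<dots> = 2 * vol E S" using g(2) by (simp add: vol_def sum.If_cases Int_def)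
  finally show ?thesis .
qed

lemma cut_size_le_vol:
  assumes "finite E"
  shows "cut_size V E S \<le> vol E S" "cut_size V E S \<le> vol E (V - S)"
  unfolding cut_size_def vol_def using assms by (auto intro!: card_mono)

text \<open>Positive degrees give both sides of a proper nonempty \<open>S\<close> positive volume,
  so \<open>S\<close> takes part in the minimum that defines
  \<open>graph_conductance\<close>.\<close>

lemma cut_size_expander:
  assumes g: "simple_graph V E" and ex: "expander \<phi> V E"
    and deg: "\<And>v. v \<in> V \<Longrightarrow> incident E v \<noteq> {}" and S: "S \<subset> V" "S \<noteq> {}"
  shows "\<phi> * real (min (vol E S) (vol E (V - S))) \<le> real (cut_size V E S)"
    and "0 < min (vol E S) (vol E (V - S))"
proof -
  note fin = simple_graphD[OF g]
  let ?CC = "{S. S \<subset> V \<and> 0 < vol E S \<and> 0 < vol E (V - S)}"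
  have pos: "0 < vol E S'" if "S' \<subseteq> V" "S' \<noteq> {}" for S'
  proof -
    obtain v where "v \<in> S'" using \<open>S' \<noteq> {}\<close> by blast
    then have "incident E v \<noteq> {}" using deg \<open>S' \<subseteq> V\<close> by blast
    then obtain e where "e \<in> incident E v" by blast
    then have "{e \<in> E. e \<inter> S' \<noteq> {}} \<noteq> {}" using \<open>v \<in> S'\<close> by (auto simp: incident_def)
    then show ?thesis using fin(2) by (simp add: vol_def card_gt_0_iff)
  qed
  have "finite ?CC" using fin(1) by (auto intro: finite_subset[of _ "Pow V"])
  moreover have "S \<in> ?CC" using pos[of S] pos[of "V - S"] S by auto
  ultimately have "graph_conductance V E \<le> cut_conductance V E S"
    unfolding graph_conductance_def by (intro Min_le) auto
  then have "\<phi> \<le> cut_conductance V E S" using ex by (simp add: expander_def)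
  moreover show m: "0 < min (vol E S) (vol E (V - S))" using \<open>S \<in> ?CC\<close> by simp
  ultimately show "\<phi> * real (min (vol E S) (vol E (V - S))) \<le> real (cut_size V E S)"
    unfolding cut_conductance_def by (subst (asm) pos_le_divide_eq) simp_all
qed

lemma conductance_le_1:
  assumes "simple_graph V E" "expander \<phi> V E"
    and "\<And>v. v \<in> V \<Longrightarrow> incident E v \<noteq> {}" "S \<subset> V" "S \<noteq> {}"
  shows "\<phi> \<le> 1"
proof -
  let ?m = "min (vol E S) (vol E (V - S))"
  have "\<phi> * real ?m \<le> real (cut_size V E S)" "0 < ?m"
    using cut_size_expander[OF assms] by auto
  moreover have "cut_size V E S \<le> ?m"
    using cut_size_le_vol[OF simple_graphD(2)[OF assms(1)], of V S] by simp
  ultimately have "\<phi> * real ?m \<le> 1 * real ?m" by linarith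
  then show ?thesis using \<open>0 < ?m\<close> by (simp only: mult_le_cancel_right)
qed

section \<open>Probability of a slow step, and the union over all cuts\<close>

lemma sum_power_card_Pow:
  fixes z :: "'a :: comm_semiring_1"
  assumes "finite X"
  shows "(\<Sum>S\<in>Pow X. z ^ card S) = (1 + z) ^ card X"
  using prod_add[OF assms, of "\<lambda>_. z" "\<lambda>_. 1"] by (simp add: add.commute)

text \<open>By the binomial theorem the sum is \<open>(1 + z) ^ card X - 1\<close>. For
  \<open>y = card X * z\<close> in the unit interval this is at most \<open>exp y - 1\<close>, hence
  at most \<open>y + y * y\<close> and so at most \<open>2 * y\<close>.\<close>

lemma sum_power_card_nonempty_le:
  fixes z :: real
  assumes "finite X" "0 \<le> z" "real (card X) * z \<le> 1"
  shows "(\<Sum>S\<in>Pow X - {{}}. z ^ card S) \<le> 2 * (real (card X) * z)"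
proof -
  have "(\<Sum>S\<in>Pow X - {{}}. z ^ card S) = (1 + z) ^ card X - 1"
    using assms(1) sum_power_card_Pow[OF assms(1), of z] by (simp add: sum_diff1)
  also have "(1 + z) ^ card X \<le> exp z ^ card X"
    using assms(2) by (intro power_mono) auto
  also have "exp z ^ card X = exp (real (card X) * z)" by (simp add: exp_of_nat_mult)
  also have "\<dots> \<le> 1 + real (card X) * z + (real (card X) * z)\<^sup>2"
    using assms by (intro exp_bound) auto
  also have "(real (card X) * z)\<^sup>2 \<le> real (card X) * z"
    using assms by (simp add: power2_eq_square mult_left_le)
  finally show ?thesis by (simp add: mult.commute)
qed

context arc_sampling
begin

abbreviation new_nodes :: "'w \<Rightarrow> nat \<Rightarrow> node set \<Rightarrow> node set" where
  "new_nodes w i S \<equiv> flood_step E (\<lambda>v. {e. hit w v i e}) S - S"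

lemma new_nodes_subset: "new_nodes w i S \<subseteq> V - S"
  using graphD(3) by (auto simp: flood_step_def)

text \<open>
  If the new nodes have small degree sum, they touch at most half of the cut, so the other
  half of the cut was not sampled. Summing over the possible sets \<open>W\<close> of new nodes costs less
  than the resulting exponential gain, because every node of \<open>W\<close> has degree at least \<open>\<Delta>\<close>.
\<close>

lemma prob_slow_step:
  fixes \<Delta> :: real
  assumes S: "S \<subseteq> V" and i: "i < L" and \<Delta>: "0 < \<Delta>" "\<And>v. v \<in> V \<Longrightarrow> \<Delta> \<le> real (card (incident E v))"
    and ln: "ln (real (card V) + 1) \<le> p * \<Delta> / 2"
  shows "measure_pmf.prob M {w. 2 * degree_sum E (new_nodes w i S) \<le> cut_size V E S}
    \<le> exp (- (p * real (cut_size V E S) / 4))"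
proof -
  note fin = graphD
  let ?c = "real (cut_size V E S)"
  let ?WW = "{W. W \<subseteq> V - S \<and> 2 * degree_sum E W \<le> cut_size V E S}"
  \<comment> \<open>The arcs from \<open>S\<close> into nodes outside both \<open>S\<close> and
    \<open>W\<close>. If \<open>W\<close> is exactly the set of new nodes, none of them is
    sampled.\<close>
  let ?Z = "\<lambda>W. {(v, j, e). v \<in> V - S - W \<and> j = i \<and> e \<in> incident E v \<and> e \<inter> S \<noteq> {}}"
  have Z: "?Z W \<subseteq> (SIGMA v:V. {..<L} \<times> incident E v)" for W using i by auto
  have finZ: "finite (?Z W)" for W
    using fin(1,2) by (intro finite_subset[OF Z] finite_SigmaI finite_cartesian_product finite_incident) auto
  have finW: "finite ?WW" using fin(1) by (auto intro: finite_subset[of _ "Pow V"])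
  have "{w. 2 * degree_sum E (new_nodes w i S) \<le> cut_size V E S} \<subseteq>
      (\<Union>W\<in>?WW. {w. \<forall>(v, j, e)\<in>?Z W. \<not> hit w v j e})"
  proof
    fix w assume w: "w \<in> {w. 2 * degree_sum E (new_nodes w i S) \<le> cut_size V E S}"
    have "\<not> hit w v i e"
      if v: "v \<in> V - S - new_nodes w i S" "e \<in> incident E v" "e \<inter> S \<noteq> {}" for v e
    proof
      assume hit: "hit w v i e"
      obtain u where u: "u \<in> e" "u \<in> S" using v(3) by blast
      have e: "e \<in> E" "v \<in> e" using v(2) by (auto simp: incident_def)
      have "card e = 2" using e(1) fin(4) by simp
      then obtain x y where "e = {x, y}" "x \<noteq> y" by (meson card_2_iff)
      then have "e = {u, v}" using u e(2) v(1) by auto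
      then have "v \<in> new_nodes w i S" using hit e(1) u(2) v(1) by (auto simp: flood_step_def)
      then show False using v(1) by blast
    qed
    then show "w \<in> (\<Union>W\<in>?WW. {w. \<forall>(v, j, e)\<in>?Z W. \<not> hit w v j e})"
      using w new_nodes_subset[of w i S] by (intro UN_I[of "new_nodes w i S"]) auto
  qed
  then have "measure_pmf.prob M {w. 2 * degree_sum E (new_nodes w i S) \<le> cut_size V E S} \<le>
      measure_pmf.prob M (\<Union>W\<in>?WW. {w. \<forall>(v, j, e)\<in>?Z W. \<not> hit w v j e})"
    by (intro measure_pmf.finite_measure_mono) auto
  also have "\<dots> \<le> (\<Sum>W\<in>?WW. measure_pmf.prob M {w. \<forall>(v, j, e)\<in>?Z W. \<not> hit w v j e})"
    using finW by (intro measure_UNION_le) auto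
  also have "\<dots> \<le> (\<Sum>W\<in>?WW. exp (- (p * ?c / 2)))"
  proof (intro sum_mono)
    fix W assume "W \<in> ?WW"
    then have W: "W \<subseteq> V - S" "2 * degree_sum E W \<le> cut_size V E S" by auto
    have finW: "finite W" using W(1) fin(1) by (meson finite_Diff finite_subset)
    \<comment> \<open>A cut edge whose outer endpoint avoids \<open>W\<close> gives an arc of
      \<open>?Z W\<close>; the others number at most \<open>degree_sum E W\<close>, which is at most
      half of the cut.\<close>
    have "{e \<in> E. e \<inter> S \<noteq> {} \<and> e \<inter> (V - S) \<noteq> {}} \<subseteq>
        (\<lambda>(v, j, e). e) ` ?Z W \<union> (\<Union>v\<in>W. incident E v)"
    proof
      fix e assume e: "e \<in> {e \<in> E. e \<inter> S \<noteq> {} \<and> e \<inter> (V - S) \<noteq> {}}"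
      then obtain v where v: "v \<in> e" "v \<in> V - S" by blast
      show "e \<in> (\<lambda>(v, j, e). e) ` ?Z W \<union> (\<Union>v\<in>W. incident E v)"
      proof (cases "v \<in> W")
        case True
        then show ?thesis using e v by (auto simp: incident_def)
      next
        case False
        then have "(v, i, e) \<in> ?Z W" using e v by (auto simp: incident_def)
        then show ?thesis by force
      qed
    qed
    then have "cut_size V E S \<le> card ((\<lambda>(v, j, e). e) ` ?Z W \<union> (\<Union>v\<in>W. incident E v))"
      unfolding cut_size_def using finZ finW fin(2)
      by (intro card_mono) (blast intro: finite_incident)+
    also have "\<dots> \<le> card ((\<lambda>(v, j, e). e) ` ?Z W) + card (\<Union>v\<in>W. incident E v)"
      by (rule card_Un_le)
    also have "\<dots> \<le> card (?Z W) + degree_sum E W"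
      unfolding degree_sum_def using finZ finW by (intro add_mono card_image_le card_UN_le)
    finally have card: "?c / 2 \<le> real (card (?Z W))" using W(2) by linarith
    have "measure_pmf.prob M {w. \<forall>(v, j, e)\<in>?Z W. \<not> hit w v j e} = (1 - p) ^ card (?Z W)"
      by (rule prob_none_hit[OF Z])
    also have "\<dots> \<le> exp (- p) ^ card (?Z W)"
      using p_le_1 exp_ge_add_one_self[of "- p"] by (intro power_mono) auto
    also have "\<dots> = exp (- (p * real (card (?Z W))))"
      by (simp add: mult.commute flip: exp_of_nat_mult)
    also have "\<dots> \<le> exp (- (p * ?c / 2))"
      using mult_left_mono[OF card p_nonneg] by simp
    finally show "measure_pmf.prob M {w. \<forall>(v, j, e)\<in>?Z W. \<not> hit w v j e} \<le> exp (- (p * ?c / 2))" .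
  qed
  also have "\<dots> = real (card ?WW) * exp (- (p * ?c / 2))" by simp
  also have "\<dots> \<le> exp (p * ?c / 4) * exp (- (p * ?c / 2))"
  proof (intro mult_right_mono)
    \<comment> \<open>Each node of \<open>W\<close> contributes at least \<open>\<Delta>\<close> to
      a degree sum of at most \<open>?c / 2\<close>, which bounds \<open>card W\<close>. The
      assumption on \<open>ln\<close> then lets the number of such \<open>W\<close> consume only
      half of the exponent \<open>p * ?c / 2\<close>.\<close>
    define q where "q = nat \<lfloor>?c / (2 * \<Delta>)\<rfloor>"
    have q: "real q \<le> ?c / (2 * \<Delta>)" using \<Delta>(1) by (simp add: q_def)
    have "?WW \<subseteq> {W. W \<subseteq> V \<and> card W \<le> q}"
    proof
      fix W assume W: "W \<in> ?WW"
      have "real (card W) * \<Delta> = (\<Sum>v\<in>W. \<Delta>)" by simp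
      also have "\<dots> \<le> (\<Sum>v\<in>W. real (card (incident E v)))"
        using W \<Delta>(2) by (intro sum_mono) auto
      also have "\<dots> = real (degree_sum E W)" by (simp add: degree_sum_def)
      finally have "real (card W) * \<Delta> \<le> ?c / 2" using W by auto
      then have "real (card W) \<le> ?c / (2 * \<Delta>)" using \<Delta>(1) by (simp add: field_simps)
      then have "card W \<le> q" unfolding q_def by (simp add: le_nat_iff le_floor_iff)
      then show "W \<in> {W. W \<subseteq> V \<and> card W \<le> q}" using W by auto
    qed
    then have "card ?WW \<le> card {W. W \<subseteq> V \<and> card W \<le> q}" using fin(1) by (intro card_mono) auto
    also have "\<dots> \<le> (card V + 1) ^ q" by (rule card_bounded_subsets_le[OF fin(1)])
    finally have "real (card ?WW) \<le> real ((card V + 1) ^ q)" by (simp only: of_nat_le_iff)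
    also have "\<dots> = (real (card V) + 1) ^ q" by (simp add: add.commute)
    also have "\<dots> = exp (real q * ln (real (card V) + 1))"
      by (subst exp_of_nat_mult) simp
    also have "\<dots> \<le> exp (p * ?c / 4)"
    proof -
      have "real q * ln (real (card V) + 1) \<le> ?c / (2 * \<Delta>) * (p * \<Delta> / 2)"
        using q ln by (intro mult_mono) auto
      also have "\<dots> = p * ?c / 4" using \<Delta>(1) by (simp add: field_simps)
      finally show ?thesis by simp
    qed
    finally show "real (card ?WW) \<le> exp (p * ?c / 4)" .
  qed simp
  also have "\<dots> = exp (- (p * ?c / 4))" by (simp flip: exp_add)
  finally show ?thesis .
qed

text \<open>A flood reuses its listening sets in all steps, so the reached set depends on the
  samples and all cuts must be handled at once. If the smaller side has \<open>m\<close> nodes,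
  expansion gives at least \<open>\<phi> * \<Delta> * m / 2\<close> cut edges, hence probability at
  most \<open>z ^ m\<close>.\<close>

lemma prob_some_slow_step:
  fixes \<Delta> \<phi> z :: real
  assumes \<Delta>: "0 < \<Delta>" "\<And>v. v \<in> V \<Longrightarrow> \<Delta> \<le> real (card (incident E v))"
    and ln: "ln (real (card V) + 1) \<le> p * \<Delta> / 2"
    and ex: "expander \<phi> V E" and \<phi>: "0 < \<phi>"
    and z: "z = exp (- (p * \<phi> * \<Delta> / 8))" "real (card V) * z \<le> 1"
  shows "measure_pmf.prob M {w. \<exists>i<L. \<exists>S. S \<subset> V \<and> S \<noteq> {} \<and>
      2 * degree_sum E (new_nodes w i S) \<le> cut_size V E S}
    \<le> 4 * real L * real (card V) * z"
proof -
  note fin = graphD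
  let ?SS = "{S. S \<subset> V \<and> S \<noteq> {}}"
  let ?B = "\<lambda>(i, S). {w. 2 * degree_sum E (new_nodes w i S) \<le> cut_size V E S}"
  have finS: "finite ?SS" using fin(1) by (auto intro: finite_subset[of _ "Pow V"])
  have z01: "0 \<le> z" by (simp add: z)
  have deg: "incident E v \<noteq> {}" if "v \<in> V" for v using \<Delta> that by fastforce
  have "{w. \<exists>i<L. \<exists>S. S \<subset> V \<and> S \<noteq> {} \<and> 2 * degree_sum E (new_nodes w i S) \<le> cut_size V E S} =
      (\<Union>x\<in>{..<L} \<times> ?SS. ?B x)" by auto
  then have "measure_pmf.prob M {w. \<exists>i<L. \<exists>S. S \<subset> V \<and> S \<noteq> {} \<and>
      2 * degree_sum E (new_nodes w i S) \<le> cut_size V E S} \<le>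
      (\<Sum>x\<in>{..<L} \<times> ?SS. measure_pmf.prob M (?B x))"
    using finS by (simp only:) (intro measure_UNION_le, auto)
  also have "\<dots> \<le> (\<Sum>(i, S)\<in>{..<L} \<times> ?SS. z ^ card S + z ^ card (V - S))"
  proof (rule sum_mono)
    fix x assume "x \<in> {..<L} \<times> ?SS"
    then obtain i S where x: "x = (i, S)" and i: "i < L" and S: "S \<subset> V" "S \<noteq> {}" by auto
    let ?m = "min (card S) (card (V - S))"
    have vol: "\<Delta> * real (card S') / 2 \<le> real (vol E S')" if "S' \<subseteq> V" for S'
    proof -
      have "real (card S') * \<Delta> = (\<Sum>v\<in>S'. \<Delta>)" by simp
      also have "\<dots> \<le> (\<Sum>v\<in>S'. real (card (incident E v)))"
        using that \<Delta>(2) by (intro sum_mono) auto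
      also have "\<dots> = real (degree_sum E S')" by (simp add: degree_sum_def)
      also have "\<dots> \<le> 2 * real (vol E S')"
        using degree_sum_le_vol[OF graph that] by linarith
      finally show ?thesis by (simp add: mult.commute)
    qed
    have "\<Delta> * real ?m / 2 \<le> real (min (vol E S) (vol E (V - S)))"
    proof -
      have "\<Delta> * real ?m \<le> \<Delta> * real (card S)" "\<Delta> * real ?m \<le> \<Delta> * real (card (V - S))"
        using \<Delta>(1) by simp_all
      then show ?thesis using vol[of S] vol[of "V - S"] S by (auto simp: min_def)
    qed
    then have "\<phi> * (\<Delta> * real ?m / 2) \<le> \<phi> * real (min (vol E S) (vol E (V - S)))"
      using \<phi> by (intro mult_left_mono) auto
    also have "\<dots> \<le> real (cut_size V E S)" by (rule cut_size_expander(1)[OF graph ex deg S])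
    finally have cut: "p * (\<phi> * (\<Delta> * real ?m / 2)) \<le> p * real (cut_size V E S)"
      using p_nonneg by (rule mult_left_mono)
    have "measure_pmf.prob M (?B x) \<le> exp (- (p * real (cut_size V E S) / 4))"
      using prob_slow_step[OF _ i \<Delta> ln, of S] S x by simp
    also have "\<dots> \<le> exp (real ?m * (- (p * \<phi> * \<Delta> / 8)))"
      using cut by (simp add: algebra_simps)
    also have "\<dots> = z ^ ?m" unfolding z(1) by (rule exp_of_nat_mult)
    \<comment> \<open>Trading the minimum for a sum allows each term to be summed over all subsets
      by the binomial theorem; complementation identifies the two sums.\<close>
    also have "\<dots> \<le> z ^ card S + z ^ card (V - S)"
      using z01 by (simp add: min_def)
    finally show "measure_pmf.prob M (?B x) \<le> (case x of (i, S) \<Rightarrow> z ^ card S + z ^ card (V - S))"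
      by (simp add: x)
  qed
  also have "\<dots> = real L * ((\<Sum>S\<in>?SS. z ^ card S) + (\<Sum>S\<in>?SS. z ^ card (V - S)))"
    by (simp add: sum.distrib flip: sum.cartesian_product)
  also have "(\<Sum>S\<in>?SS. z ^ card (V - S)) = (\<Sum>S\<in>?SS. z ^ card S)"
    by (rule sum.reindex_bij_witness[of _ "\<lambda>S. V - S" "\<lambda>S. V - S"]) auto
  also have "real L * ((\<Sum>S\<in>?SS. z ^ card S) + (\<Sum>S\<in>?SS. z ^ card S)) \<le>
      real L * (2 * (real (card V) * z) + 2 * (real (card V) * z))"
  proof -
    have "(\<Sum>S\<in>?SS. z ^ card S) \<le> (\<Sum>S\<in>Pow V - {{}}. z ^ card S)"
      using fin(1) z01 by (intro sum_mono2) auto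
    also have "\<dots> \<le> 2 * (real (card V) * z)"
      using sum_power_card_nonempty_le[OF fin(1) z01 z(2)] .
    finally show ?thesis by (intro mult_left_mono add_mono) auto
  qed
  finally show ?thesis by (simp add: algebra_simps)
qed

end

text \<open>There are two phases of \<open>K\<close> steps: below \<open>T / 2\<close> the value
  grows by the factor \<open>1 + \<phi> / 4\<close> per step, and afterwards the gap to
  \<open>T\<close> shrinks by the factor \<open>1 - \<phi> / 4\<close>.\<close>

lemma logistic_growth:
  fixes a :: "nat \<Rightarrow> real"
  assumes \<phi>: "0 < \<phi>" "\<phi> \<le> 1" and a0: "1 \<le> a 0" and aT: "\<And>k. a k \<le> T"
    and step: "\<And>k. a k + \<phi> / 4 * min (a k) (T - a k) \<le> a (Suc k)"
    and K: "ln T < real K * \<phi> / 8"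
  shows "T - a (2 * K) < 1"
proof -
  have T: "1 \<le> T" using a0 aT[of 0] by simp
  have a1: "1 \<le> a k \<and> a k \<le> a (Suc k)" for k
  proof -
    have inc: "a k \<le> a (Suc k)" if "1 \<le> a k" for k
    proof -
      have "0 \<le> \<phi> / 4 * min (a k) (T - a k)" using that aT[of k] \<phi> by simp
      then show ?thesis using step[of k] by simp
    qed
    have "1 \<le> a k" by (induction k) (use a0 inc in \<open>auto intro: order_trans\<close>)
    then show ?thesis using inc by blast
  qed
  then have mono: "incseq a" by (intro incseq_SucI) blast
  have grow: "(1 + \<phi> / 4) ^ k \<le> a k \<or> T / 2 \<le> a k" for k
  proof (induction k)
    case 0
    then show ?case using a0 by simp
  next
    case (Suc k)
    show ?case
    proof (cases "T / 2 \<le> a k")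
      case True
      then show ?thesis using a1[of k] by auto
    next
      case False
      then have "(1 + \<phi> / 4) * (1 + \<phi> / 4) ^ k \<le> (1 + \<phi> / 4) * a k"
        using Suc \<phi>(1) by (intro mult_left_mono) auto
      also have "\<dots> = a k + \<phi> / 4 * min (a k) (T - a k)"
        using False by (simp add: algebra_simps min_def)
      also have "\<dots> \<le> a (Suc k)" by (rule step)
      finally show ?thesis by simp
    qed
  qed
  have half: "T / 2 \<le> a K"
  proof (rule ccontr)
    assume "\<not> T / 2 \<le> a K"
    then have "(1 + \<phi> / 4) ^ K \<le> T" using grow[of K] aT[of K] by linarith
    \<comment> \<open>Together with the next line this gives
      \<open>exp (\<phi> / 8) \<le> 1 + \<phi> / 4\<close>, the origin of the 8 in the assumption on
      \<open>K\<close>.\<close>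
    moreover have "exp (\<phi> / 8) \<le> 1 + \<phi> / 8 + (\<phi> / 8)\<^sup>2" using \<phi> by (intro exp_bound) auto
    moreover have "(\<phi> / 8)\<^sup>2 \<le> \<phi> / 8" using \<phi> by (simp add: power2_eq_square mult_left_le)
    ultimately have "exp (\<phi> / 8) ^ K \<le> T"
      using power_mono[of "exp (\<phi> / 8)" "1 + \<phi> / 4" K] by simp
    moreover have "exp (\<phi> / 8) ^ K = exp (real K * \<phi> / 8)"
      by (simp flip: exp_of_nat_mult)
    moreover have "T < exp (real K * \<phi> / 8)"
      using K T by (metis exp_less_cancel_iff exp_ln less_le_trans zero_less_one)
    ultimately show False by simp
  qed
  have decay: "T - a (K + j) \<le> (1 - \<phi> / 4) ^ j * T" for j
  proof (induction j)
    case 0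
    then show ?case using half a1[of K] by simp
  next
    case (Suc j)
    have "T / 2 \<le> a (K + j)" using half incseqD[OF mono, of K "K + j"] by simp
    then have "a (K + j) + \<phi> / 4 * (T - a (K + j)) \<le> a (K + Suc j)"
      using step[of "K + j"] by (simp add: min_absorb2)
    then have "T - a (K + Suc j) \<le> (1 - \<phi> / 4) * (T - a (K + j))"
      by (simp add: algebra_simps)
    also have "\<dots> \<le> (1 - \<phi> / 4) * ((1 - \<phi> / 4) ^ j * T)"
      using Suc \<phi> by (intro mult_left_mono) auto
    finally show ?case by (simp add: mult.assoc)
  qed
  have "T - a (2 * K) \<le> (1 - \<phi> / 4) ^ K * T" using decay[of K] by (simp add: mult_2)
  also have "\<dots> \<le> exp (- (\<phi> / 4)) ^ K * T"
    using \<phi> T exp_ge_add_one_self[of "- (\<phi> / 4)"] by (intro mult_right_mono power_mono) auto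
  also have "exp (- (\<phi> / 4)) ^ K = exp (- (real K * \<phi> / 4))" by (simp flip: exp_of_nat_mult)
  also have "\<dots> * T = exp (ln T - real K * \<phi> / 4)"
    using T exp_add[of "- (real K * \<phi> / 4)" "ln T"] by simp
  also have "\<dots> < 1"
  proof -
    have "0 \<le> real K * \<phi> / 8" using \<phi> by simp
    then show ?thesis using K by simp
  qed
  finally show ?thesis .
qed

text \<open>The growth lemma is applied to the degree sum of the reached set. The rate
  \<open>\<phi> / 4\<close> loses one factor 2 because the new nodes are only guaranteed more than
  half of the cut, and another through \<open>degree_sum_le_vol\<close>.\<close>

lemma flood_reaches_all:
  fixes \<phi> :: real
  assumes graph: "simple_graph V E" and ex: "expander \<phi> V E" and \<phi>: "0 < \<phi>"
    and deg: "\<And>v. v \<in> V \<Longrightarrow> incident E v \<noteq> {}" and s: "s \<in> V" "V \<noteq> {s}"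
    and fast: "\<And>S. S \<subset> V \<Longrightarrow> S \<noteq> {} \<Longrightarrow> cut_size V E S < 2 * degree_sum E (flood_step E Q S - S)"
    and K: "ln (real (degree_sum E V)) < real K * \<phi> / 8"
  shows "V \<subseteq> (flood_step E Q ^^ (2 * K)) {s}"
proof -
  note fin = simple_graphD[OF graph]
  define S where "S k = (flood_step E Q ^^ k) {s}" for k
  define a where "a k = real (degree_sum E (S k))" for k
  have S_Suc: "S (Suc k) = flood_step E Q (S k)" for k by (simp add: S_def)
  have sub: "S k \<subseteq> V" for k
  proof (induction k)
    case (Suc k)
    then show ?case using fin(3) by (fastforce simp: S_Suc flood_step_def)
  qed (use s in \<open>simp add: S_def\<close>)
  have mem: "s \<in> S k" for k by (induction k) (auto simp: S_def flood_step_def)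
  have finS: "finite S'" if "S' \<subseteq> V" for S' using that fin(1) finite_subset by blast
  have pos: "card S' \<le> degree_sum E S'" if "S' \<subseteq> V" for S'
  proof -
    have "card S' = (\<Sum>v\<in>S'. 1)" by simp
    also have "\<dots> \<le> degree_sum E S'"
      unfolding degree_sum_def using that deg finite_incident[OF fin(2)]
      by (intro sum_mono) (auto simp: Suc_le_eq card_gt_0_iff)
    finally show ?thesis .
  qed
  have split: "degree_sum E (V - S k) = degree_sum E V - degree_sum E (S k)"
    "degree_sum E (S k) \<le> degree_sum E V" for k
    using degree_sum_Un_disjoint[of "S k" "V - S k" E] sub[of k] finS fin(1)
    by (auto simp: Un_absorb1)
  have "real (degree_sum E V) - a (2 * K) < 1"
  proof (rule logistic_growth[OF \<phi>])
    show "\<phi> \<le> 1" using s by (intro conductance_le_1[OF graph ex deg, of "{s}"]) auto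
    show "1 \<le> a 0" using pos[of "{s}"] s by (simp add: a_def S_def)
    show "a k \<le> real (degree_sum E V)" for k using split(2) by (simp add: a_def)
    show "a k + \<phi> / 4 * min (a k) (real (degree_sum E V) - a k) \<le> a (Suc k)" for k
    proof (cases "S k = V")
      case True
      then have "S (Suc k) = V" using sub[of "Suc k"] by (auto simp: S_Suc flood_step_def)
      then show ?thesis using True by (simp add: a_def min_def)
    next
      case False
      then have Sk: "S k \<subset> V" "S k \<noteq> {}" using sub mem by blast+
      let ?N = "flood_step E Q (S k) - S k"
      have eq: "S (Suc k) = S k \<union> ?N" by (auto simp: S_Suc flood_step_def)
      have "?N \<subseteq> V" using sub[of "Suc k"] S_Suc by auto
      then have a: "a (Suc k) = a k + real (degree_sum E ?N)"
        unfolding a_def by (subst eq, subst degree_sum_Un_disjoint) (use sub finS in auto)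
      have "min (a k) (real (degree_sum E V) - a k) \<le>
          2 * real (min (vol E (S k)) (vol E (V - S k)))"
      proof -
        have "a k \<le> 2 * real (vol E (S k))"
          using degree_sum_le_vol[OF graph sub[of k]] unfolding a_def by linarith
        moreover have "real (degree_sum E V) - a k \<le> 2 * real (vol E (V - S k))"
          using degree_sum_le_vol[OF graph, of "V - S k"] split[of k] unfolding a_def by auto
        ultimately show ?thesis by (auto simp: min_def)
      qed
      then have "\<phi> / 4 * min (a k) (real (degree_sum E V) - a k) \<le>
          \<phi> / 4 * (2 * real (min (vol E (S k)) (vol E (V - S k))))"
        using \<phi> by (intro mult_left_mono) auto
      also have "\<dots> \<le> real (cut_size V E (S k)) / 2"
        using cut_size_expander(1)[OF graph ex deg Sk] by simp
      also have "\<dots> \<le> real (degree_sum E ?N)" using fast[OF Sk] by linarith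
      finally show ?thesis by (simp add: a)
    qed
  qed (rule K)
  \<comment> \<open>A natural number below 1 vanishes; positive degrees then leave no unreached
    node.\<close>
  then have "degree_sum E (V - S (2 * K)) = 0"
    unfolding split(1) a_def using split(2)[of "2 * K"] by linarith
  then have "card (V - S (2 * K)) = 0" using pos[of "V - S (2 * K)"] by auto
  then show ?thesis using finS[of "V - S (2 * K)"] by (auto simp: S_def)
qed

section \<open>The broadcast protocol\<close>

text \<open>With \<open>k\<close> fair bits, a fixed table entry has probability
  \<open>1 / 2 ^ k\<close>. For positive \<open>t\<close>, the least suitable exponent puts the
  listening probability between \<open>1 / (64 * t)\<close> and \<open>1 / (32 * t)\<close>.\<close>

definition listen_bits :: "nat \<Rightarrow> nat" where
  "listen_bits t = (LEAST k. 32 * t \<le> 2 ^ k)"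

lemma listen_bits:
  assumes "1 \<le> t"
  shows "32 * t \<le> 2 ^ listen_bits t" "2 ^ listen_bits t < 64 * t"
proof -
  have "32 * t \<le> 2 ^ (32 * t)" by (intro less_imp_le less_exp)
  then show *: "32 * t \<le> 2 ^ listen_bits t" unfolding listen_bits_def by (rule LeastI)
  then obtain k where k: "listen_bits t = Suc k" using assms by (cases "listen_bits t") auto
  then have "\<not> 32 * t \<le> 2 ^ k"
    using not_less_Least[of k "\<lambda>k. 32 * t \<le> 2 ^ k"] by (simp add: listen_bits_def)
  then show "2 ^ listen_bits t < 64 * t" by (simp add: k)
qed

text \<open>Nodes know \<open>N\<close> but not \<open>n\<close>. Since \<open>log 2 N\<close> may
  be smaller than \<open>log 2 n\<close> by the factor \<open>\<kappa>\<close>, the last factor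
  compensates for it. The role of \<open>a + 4\<close> appears in
  \<open>corruption_bound\<close>.\<close>

definition flood_count :: "real \<Rightarrow> real \<Rightarrow> nat \<Rightarrow> nat \<Rightarrow> nat" where
  "flood_count \<kappa> a N t = t * nat \<lceil>log 2 (real N)\<rceil> * nat \<lceil>\<kappa> * (a + 4)\<rceil>"

text \<open>
  Edges that are not ports have the default table entry 0 and are formally listened to; this is
  harmless, since nothing is ever received over them.
\<close>

definition listening :: "(nat \<Rightarrow> nat \<Rightarrow> nat) \<Rightarrow> knowledge \<Rightarrow> bool list \<Rightarrow> nat \<Rightarrow> edge set" where
  "listening L K cs i = {e. coin_table (listen_bits (fault_bound K))
     ({..<L (size_estimate K) (fault_bound K)} \<times> ports K) cs (i, e) = 0}"

definition flood_protocol :: "(nat \<Rightarrow> nat \<Rightarrow> nat) \<Rightarrow> protocol" where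
  "flood_protocol L =
     \<lparr>num_coins = \<lambda>K. listen_bits (fault_bound K) *
        card ({..<L (size_estimate K) (fault_bound K)} \<times> ports K),
      send = \<lambda>K cs h e. flood_send (source_input K) (L (size_estimate K) (fault_bound K))
        (listening L K cs) h,
      decide = \<lambda>K cs. flood_decide (source_input K) (L (size_estimate K) (fault_bound K))
        (listening L K cs)\<rparr>"

lemma arc_sampling_flood_protocol:
  assumes graph: "simple_graph V E"
  shows "arc_sampling (coin_pmf (flood_protocol L) (initial_knowledge E N t s m0) V) V E (L N t)
    (1 / 2 ^ listen_bits t)
    (\<lambda>\<omega> v i e. e \<in> listening L (initial_knowledge E N t s m0 v) (\<omega> v) i)"
proof -
  note fin = simple_graphD[OF graph]
  let ?k = "listen_bits t"
  let ?X = "\<lambda>v. {..<L N t} \<times> incident E v"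
  have M: "coin_pmf (flood_protocol L) (initial_knowledge E N t s m0) V =
      Pi_pmf V [] (\<lambda>v. pmf_of_set {xs. length xs = ?k * card (?X v)})"
    by (simp add: coin_pmf_def flood_protocol_def initial_knowledge_def)
  have hit: "e \<in> listening L (initial_knowledge E N t s m0 v) (\<omega> v) i \<longleftrightarrow>
      coin_table ?k (?X v) (\<omega> v) (i, e) \<in> {0}" for \<omega> :: coins and v i e
    by (simp add: listening_def initial_knowledge_def)
  have c0: "card ({..<2 ^ ?k::nat} \<inter> {0}) = 1" by simp
  have "{..<2 ^ ?k::nat} \<inter> - {0} = {..<2 ^ ?k} - {0}" by auto
  then have c1: "real (card ({..<2 ^ ?k::nat} \<inter> - {0})) = 2 ^ ?k - 1"
    by (simp add: of_nat_diff)
  have finX: "finite (?X v)" for v using fin(2) by (simp add: finite_incident)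
  show ?thesis
  proof
    fix Z assume Z: "Z \<subseteq> (SIGMA v:V. {..<L N t} \<times> incident E v)"
    show "measure_pmf.prob (coin_pmf (flood_protocol L) (initial_knowledge E N t s m0) V)
        {w. \<forall>(v, i, e)\<in>Z. e \<in> listening L (initial_knowledge E N t s m0 v) (w v) i} =
        (1 / 2 ^ ?k) ^ card Z"
      using prob_coin_tables[OF fin(1) finX Z, where k = ?k and B = "{0}"]
      unfolding M hit c0 by (simp add: case_prod_unfold)
    show "measure_pmf.prob (coin_pmf (flood_protocol L) (initial_knowledge E N t s m0) V)
        {w. \<forall>(v, i, e)\<in>Z. e \<notin> listening L (initial_knowledge E N t s m0 v) (w v) i} =
        (1 - 1 / 2 ^ ?k) ^ card Z"
      using prob_coin_tables[OF fin(1) finX Z, where k = ?k and B = "- {0}"]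
      unfolding M hit c1 by (simp add: case_prod_unfold diff_divide_distrib)
  qed (use graph in auto)
qed

lemma flooding_flood_protocol:
  assumes "simple_graph V E" "0 < L N t"
  shows "flooding V E s m0 (L N t)
    (\<lambda>v. listening L (initial_knowledge E N t s m0 v) (\<omega> v))
    (flood_protocol L) (initial_knowledge E N t s m0) \<omega>"
  using assms by unfold_locales (simp_all add: flood_protocol_def initial_knowledge_def)

text \<open>The deterministic analysis applies to every coin outcome outside two bad events, whose
  probabilities sum to at most \<open>q\<close>. The numerical parameters are still free
  here.\<close>

lemma solves_broadcast_flood_protocol:
  fixes B T \<Delta> \<phi> z q :: real and t :: nat and L :: "nat \<Rightarrow> nat \<Rightarrow> nat"
  defines "p \<equiv> 1 / 2 ^ listen_bits t"
  assumes graph: "simple_graph V E" and n: "2 \<le> card V" and s: "s \<in> V"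
    and t: "1 \<le> t" and L: "0 < L N t" and B: "real (length m0) \<le> B"
    and \<Delta>: "0 < \<Delta>" "\<And>v. v \<in> V \<Longrightarrow> \<Delta> \<le> real (card (incident E v))"
    and ln: "ln (real (card V) + 1) \<le> p * \<Delta> / 2"
    and ex: "expander \<phi> V E" and \<phi>: "0 < \<phi>"
    and z: "z = exp (- (p * \<phi> * \<Delta> / 8))" "real (card V) * z \<le> 1"
    and K: "ln (real (degree_sum E V)) < real K * \<phi> / 8"
    and T: "real (L N t * Suc (2 * K)) \<le> T"
    and q: "real ((card E + 1) ^ t) * (1 / 2) ^ L N t + 4 * real (L N t) * real (card V) * z \<le> q"
  shows "solves_broadcast (flood_protocol L) V E N t s m0 B T (1 - q)"
  unfolding solves_broadcast_def Let_def
proof (intro allI impI conjI)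
  fix adv assume adv: "admissible E t B adv"
  let ?I = "initial_knowledge E N t s m0"
  let ?R = "\<lambda>\<omega> v. listening L (?I v) (\<omega> v)"
  let ?M = "coin_pmf (flood_protocol L) ?I V"
  interpret arc_sampling ?M V E "L N t" p "\<lambda>\<omega> v i e. e \<in> ?R \<omega> v i"
    unfolding p_def by (rule arc_sampling_flood_protocol[OF graph])
  have deg: "incident E v \<noteq> {}" if "v \<in> V" for v using \<Delta> that by fastforce
  show "respects_bandwidth (flood_protocol L) adv E ?I V B"
    unfolding respects_bandwidth_def
  proof (intro ballI allI)
    fix \<omega> r v e assume "v \<in> V" "e \<in> incident E v"
    interpret flooding V E s m0 "L N t" "?R \<omega>" "flood_protocol L" ?I \<omega> adv
      using graph L by (rule flooding_flood_protocol)
    show "fits B (sent (flood_protocol L) E ?I \<omega> (run (flood_protocol L) adv E ?I \<omega> r) v e)"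
      using adv \<open>v \<in> V\<close> \<open>e \<in> incident E v\<close> B
      by (intro received_fits(2)) (auto simp: admissible_def)
  qed
  \<comment> \<open>Neither \<open>?corrupt\<close> nor \<open>?slow\<close> mentions
    \<open>adv\<close>, so the bounds hold for an adversary whose edges and messages depend on all
    coins.\<close>
  let ?corrupt = "{\<omega>. \<exists>F\<subseteq>E. card F \<le> t \<and>
    L N t \<le> 2 * card {i. i < L N t \<and> (\<exists>v\<in>V. \<exists>e\<in>F. e \<in> incident E v \<and> e \<in> ?R \<omega> v i)}}"
  let ?slow = "{\<omega>. \<exists>i<L N t. \<exists>S. S \<subset> V \<and> S \<noteq> {} \<and>
    2 * degree_sum E (new_nodes \<omega> i S) \<le> cut_size V E S}"
  let ?done = "{\<omega>. broadcast_done (flood_protocol L) adv E ?I V m0 T \<omega>}"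
  have "- ?done \<subseteq> ?corrupt \<union> ?slow"
  proof
    fix \<omega> assume "\<omega> \<in> - ?done"
    show "\<omega> \<in> ?corrupt \<union> ?slow"
    proof (rule ccontr)
      assume nb: "\<omega> \<notin> ?corrupt \<union> ?slow"
      interpret flooding V E s m0 "L N t" "?R \<omega>" "flood_protocol L" ?I \<omega> adv
        using graph L by (rule flooding_flood_protocol)
      have "controlled adv \<omega> \<subseteq> E" "card (controlled adv \<omega>) \<le> t"
        using adv by (auto simp: admissible_def)
      then have "\<not> L N t \<le> 2 * card {i. i < L N t \<and>
          (\<exists>v\<in>V. \<exists>e\<in>controlled adv \<omega>. e \<in> incident E v \<and> e \<in> ?R \<omega> v i)}"
        using nb by blast
      then have "2 * card {i. i < L N t \<and> \<not> good i} < L N t"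
        by (simp add: good_def not_le)
      then interpret flooding_good V E s m0 "L N t" "?R \<omega>" "flood_protocol L" ?I \<omega> adv
        by unfold_locales
      have "V \<subseteq> (flood_step E (\<lambda>v. ?R \<omega> v i) ^^ (2 * K)) {s}" if "i < L N t" for i
      proof (rule flood_reaches_all[OF graph ex \<phi> deg s])
        show "V \<noteq> {s}" using n by auto
        show "cut_size V E S < 2 * degree_sum E (flood_step E (\<lambda>v. ?R \<omega> v i) S - S)"
          if "S \<subset> V" "S \<noteq> {}" for S
          using nb that \<open>i < L N t\<close> by (auto simp: not_le)
      qed (use K in auto)
      then have "broadcast_done (flood_protocol L) adv E ?I V m0 T \<omega>"
        using s T by (intro broadcast_done_reach) auto
      then show False using \<open>\<omega> \<in> - ?done\<close> by simp
    qed
  qed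
  then have "measure_pmf.prob ?M (- ?done) \<le> measure_pmf.prob ?M (?corrupt \<union> ?slow)"
    by (intro measure_pmf.finite_measure_mono) auto
  also have "\<dots> \<le> measure_pmf.prob ?M ?corrupt + measure_pmf.prob ?M ?slow"
    by (intro measure_Un_le) auto
  also have "\<dots> \<le> real ((card E + 1) ^ t) * (1 / 2) ^ L N t + 4 * real (L N t) * real (card V) * z"
  proof (intro add_mono prob_many_floods_corrupted prob_some_slow_step[OF \<Delta> ln ex \<phi> z])
    have "real (32 * t) \<le> real (2 ^ listen_bits t)"
      using listen_bits(1)[OF t] by (simp only: of_nat_le_iff)
    then show "2 * real t * p \<le> 1 / 16" by (simp add: p_def field_simps)
  qed
  also note q
  finally have "measure_pmf.prob ?M (- ?done) \<le> q" .
  moreover have "measure_pmf.prob ?M (- ?done) = 1 - measure_pmf.prob ?M ?done"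
    using measure_pmf.prob_compl[of ?done ?M] by (simp add: Compl_eq_Diff_UNIV)
  ultimately show "1 - q \<le> measure_pmf.prob ?M ?done" by linarith
qed

section \<open>Numerical estimates and the choice of constants\<close>

lemma card_edges_le:
  assumes "simple_graph V E"
  shows "card E \<le> card V * card V"
proof -
  note fin = simple_graphD[OF assms]
  have "E \<subseteq> (\<lambda>(x, y). {x, y}) ` (V \<times> V)"
  proof
    fix e assume "e \<in> E"
    then have "e \<subseteq> V" "card e = 2" using fin by auto
    moreover obtain x y where "e = {x, y}" using \<open>card e = 2\<close> by (meson card_2_iff)
    ultimately show "e \<in> (\<lambda>(x, y). {x, y}) ` (V \<times> V)" by auto
  qed
  then have "card E \<le> card (V \<times> V)" using fin(1) by (meson finite_SigmaI surj_card_le)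
  then show ?thesis by (simp add: card_cartesian_product)
qed

lemma flood_count_bounds:
  assumes "1 \<le> \<kappa>" "0 < a" "2 \<le> n" "1 \<le> t"
    and N: "real n powr (1 / \<kappa>) \<le> real N" "real N \<le> real n powr \<kappa>"
  shows "real t * log 2 (real n) * (a + 4) \<le> real (flood_count \<kappa> a N t)"
    and "real (flood_count \<kappa> a N t) \<le> 2 * \<kappa> * real (nat \<lceil>\<kappa> * (a + 4)\<rceil>) * (real t * log 2 (real n))"
proof -
  let ?l = "log 2 (real N)" and ?lg = "log 2 (real n)" and ?m = "nat \<lceil>\<kappa> * (a + 4)\<rceil>"
  have lg: "1 \<le> ?lg" using assms(3) by (simp add: le_log_iff)
  have "1 < real n powr (1 / \<kappa>)" using assms by (intro gr_one_powr) auto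
  then have N1: "1 < real N" using N(1) by linarith
  \<comment> \<open>As an integer above 1, \<open>N\<close> has logarithm at least 1, so rounding
    the logarithm up at most doubles it.\<close>
  then have "2 \<le> real N" by simp
  then have l1: "1 \<le> ?l" by (simp add: le_log_iff)
  have "log 2 (real n powr (1 / \<kappa>)) \<le> ?l" using N(1) N1 assms by (subst log_le_cancel_iff) auto
  then have low: "?lg / \<kappa> \<le> ?l" using assms by (simp add: log_powr)
  have "?l \<le> log 2 (real n powr \<kappa>)" using N(2) N1 assms by (subst log_le_cancel_iff) auto
  then have up: "?l \<le> \<kappa> * ?lg" using assms by (simp add: log_powr)
  have ceil: "?l \<le> real (nat \<lceil>?l\<rceil>)" "real (nat \<lceil>?l\<rceil>) \<le> 2 * (\<kappa> * ?lg)"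
    using l1 up by linarith+
  have m: "\<kappa> * (a + 4) \<le> real ?m" by linarith
  have "real t * ?lg * (a + 4) = real t * (?lg / \<kappa>) * (\<kappa> * (a + 4))" using assms by simp
  also have "\<dots> \<le> real t * real (nat \<lceil>?l\<rceil>) * real ?m"
    using low ceil(1) m lg assms by (intro mult_mono) auto
  finally show "real t * ?lg * (a + 4) \<le> real (flood_count \<kappa> a N t)"
    by (simp add: flood_count_def)
  have "real (flood_count \<kappa> a N t) = real t * real (nat \<lceil>?l\<rceil>) * real ?m"
    by (simp add: flood_count_def)
  also have "\<dots> \<le> real t * (2 * (\<kappa> * ?lg)) * real ?m"
    using ceil(2) by (intro mult_right_mono mult_left_mono) auto
  finally show "real (flood_count \<kappa> a N t) \<le> 2 * \<kappa> * real ?m * (real t * ?lg)"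
    by (simp add: mult_ac)
qed

lemma ln_le_log2: "1 \<le> x \<Longrightarrow> ln x \<le> log 2 x"
proof -
  assume "1 \<le> x"
  have "ln 2 \<le> (1::real)" using ln_le_minus_one[of 2] by simp
  then have "ln x * ln 2 \<le> ln x * 1" using \<open>1 \<le> x\<close> by (intro mult_left_mono) auto
  then show ?thesis by (simp add: log_def pos_le_divide_eq)
qed

text \<open>Put \<open>x = t * log 2 n\<close>. Of the exponent \<open>(a + 4) * x\<close>, the part
  \<open>3 * x\<close> pays for the union over edge sets, \<open>a * x\<close> gives
  \<open>n powr (- a)\<close>, and the remaining \<open>x \<ge> 1\<close> gives the factor
  1/2.\<close>

lemma corruption_bound:
  assumes n: "2 \<le> n" and m: "m \<le> n * n" and t: "1 \<le> t"
    and L: "real t * log 2 (real n) * (a + 4) \<le> real L" and a: "0 < a"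
  shows "real ((m + 1) ^ t) * (1 / 2) ^ L \<le> real n powr (- a) / 2"
proof -
  let ?x = "real t * log 2 (real n)"
  have lg: "1 \<le> log 2 (real n)" using n by (simp add: le_log_iff)
  have x: "log 2 (real n) \<le> ?x" using t lg by simp
  have "m + 1 \<le> n ^ 3"
  proof -
    have "n * n * 2 \<le> n * n * n" using n by (intro mult_left_mono) auto
    moreover have "2 * 2 \<le> n * n" using n by (intro mult_mono) auto
    ultimately show ?thesis using m unfolding power3_eq_cube by linarith
  qed
  then have "real ((m + 1) ^ t) \<le> real ((n ^ 3) ^ t)" by (intro of_nat_mono power_mono) auto
  also have "\<dots> = real n powr (real (3 * t))"
    using n by (subst powr_realpow) (auto simp flip: power_mult)
  also have "\<dots> = 2 powr (3 * ?x)"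
    using n by (subst powr_log_cancel[of 2 "real n", symmetric])
      (simp_all only: powr_powr, simp_all add: mult_ac)
  finally have 1: "real ((m + 1) ^ t) \<le> 2 powr (3 * ?x)" .
  have 2: "(1 / 2) ^ L = 2 powr (- real L)"
    by (simp add: powr_minus powr_realpow power_one_over inverse_eq_divide)
  have "real ((m + 1) ^ t) * (1 / 2) ^ L \<le> 2 powr (3 * ?x) * 2 powr (- real L)"
    unfolding 2 using 1 by (intro mult_right_mono) auto
  also have "\<dots> = 2 powr (3 * ?x - real L)" by (simp flip: powr_add)
  also have "\<dots> \<le> 2 powr (- a * log 2 (real n) - 1)"
  proof (intro powr_mono)
    have "a * log 2 (real n) \<le> a * ?x" using x a by (intro mult_left_mono) auto
    moreover have "?x * (a + 4) = a * ?x + 4 * ?x" by (simp add: algebra_simps)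
    ultimately show "3 * ?x - real L \<le> - a * log 2 (real n) - 1"
      using L x lg by linarith
  qed simp
  also have "\<dots> = real n powr (- a) / 2"
    using n by (simp add: powr_diff powr_minus mult.commute[of a] flip: powr_powr)
  finally show ?thesis .
qed

theorem theorem3:
  fixes \<kappa> a :: real
  assumes "\<kappa> \<ge> 1" and "a > 0"
  shows "\<exists>c>0. \<forall>C\<ge>c. \<exists>(A :: protocol) (\<beta> :: real) (K :: real).
    \<forall>(V :: node set) (E :: edge set) (n :: nat) (N :: nat) (t :: nat) (\<phi> :: real) (s :: node) (m0 :: msg).
      simple_graph V E \<longrightarrow> card V = n \<longrightarrow> n \<ge> 2 \<longrightarrow> t \<ge> 1 \<longrightarrow> \<phi> > 0 \<longrightarrow>
      expander \<phi> V E \<longrightarrow>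
      c * (real t ^ 2 * log 2 (real n) / \<phi>) \<le> real (min_degree V E) \<longrightarrow>
      real (min_degree V E) \<le> C * (real t ^ 2 * log 2 (real n) / \<phi>) \<longrightarrow>
      (\<forall>v\<in>V. real v < real n powr \<kappa>) \<longrightarrow>
      real n powr (1 / \<kappa>) \<le> real N \<longrightarrow> real N \<le> real n powr \<kappa> \<longrightarrow>
      s \<in> V \<longrightarrow> real (length m0) \<le> \<kappa> * log 2 (real n) \<longrightarrow>
      solves_broadcast A V E N t s m0
        (\<beta> * log 2 (real n))
        (K * (real t * (log 2 (real n)) ^ 2 / \<phi>))
        (1 - real n powr (- a))"
proof -
  define b where "b = 2 * \<kappa> * real (nat \<lceil>\<kappa> * (a + 4)\<rceil>)"
  \<comment> \<open>The number of floods is at most \<open>b * x\<close> with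
    \<open>x = t * log 2 n\<close>. In \<open>c1\<close> the 2 pays for \<open>exp x\<close>, which
    dominates \<open>x\<close>, and for the factor \<open>n\<close> from the union over cuts;
    \<open>a\<close> gives \<open>n powr (- a)\<close>, and \<open>8 * b\<close> absorbs the
    prefactor \<open>4 * b\<close>.\<close>
  define c1 where "c1 = 2 + a + 8 * b"
  have "0 < \<kappa> * (a + 4)" using assms by simp
  then have "0 < nat \<lceil>\<kappa> * (a + 4)\<rceil>" by (simp only: zero_less_nat_eq zero_less_ceiling)
  then have "1 \<le> real (nat \<lceil>\<kappa> * (a + 4)\<rceil>)" by linarith
  then have b: "0 < b" using assms by (simp add: b_def)
  have c1: "2 \<le> c1" using assms b by (simp add: c1_def)
  let ?A = "flood_protocol (flood_count \<kappa> a)"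
  have main: "solves_broadcast ?A V E N t s m0 (\<kappa> * log 2 (real n))
      (51 * b * (real t * (log 2 (real n)) ^ 2 / \<phi>)) (1 - real n powr (- a))"
    if graph: "simple_graph V E" and n: "card V = n" "n \<ge> 2" and t: "t \<ge> 1" and \<phi>: "\<phi> > 0"
      and ex: "expander \<phi> V E"
      and mind: "512 * c1 * (real t ^ 2 * log 2 (real n) / \<phi>) \<le> real (min_degree V E)"
      and N: "real n powr (1 / \<kappa>) \<le> real N" "real N \<le> real n powr \<kappa>"
      and s: "s \<in> V" and m0: "real (length m0) \<le> \<kappa> * log 2 (real n)"
    for V E n N t \<phi> s m0
  proof -
    note fin = simple_graphD[OF graph]
    let ?lg = "log 2 (real n)" and ?L = "flood_count \<kappa> a N t"
    let ?\<Delta> = "real (min_degree V E)" and ?p = "1 / 2 ^ listen_bits t :: real"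
    define x where "x = real t * ?lg"
    define z where "z = exp (- (?p * \<phi> * ?\<Delta> / 8))"
    define K where "K = nat \<lfloor>8 * ln (real (degree_sum E V)) / \<phi>\<rfloor> + 1"
    have lg: "1 \<le> ?lg" using n by (simp add: le_log_iff)
    have lnlg: "ln (real n) \<le> ?lg" using n by (intro ln_le_log2) auto
    have x: "?lg \<le> x" "1 \<le> x" using t lg mult_mono[of 1 "real t" 1 ?lg] by (auto simp: x_def)
    have L: "x * (a + 4) \<le> real ?L" "real ?L \<le> b * x"
      using flood_count_bounds[OF assms n(2) t N] unfolding b_def x_def by auto
    have "0 < x * (a + 4)" using x assms by simp
    then have L0: "0 < ?L" using L(1) by linarith
    have "0 < 512 * c1 * (real t ^ 2 * ?lg / \<phi>)" using c1 t lg \<phi> by simp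
    then have \<Delta>0: "0 < ?\<Delta>" using mind by linarith
    have \<Delta>: "?\<Delta> \<le> real (card (incident E v))" if "v \<in> V" for v
      unfolding min_degree_def using fin(1) that by (intro of_nat_mono Min_le) auto
    have deg: "incident E v \<noteq> {}" if "v \<in> V" for v using \<Delta>[OF that] \<Delta>0 by fastforce
    have nV: "V \<noteq> {s}" using n by auto
    have \<phi>1: "\<phi> \<le> 1" using s nV by (intro conductance_le_1[OF graph ex deg, of "{s}"]) auto
    have p: "1 / (64 * real t) \<le> ?p"
    proof -
      have "real (2 ^ listen_bits t) \<le> real (64 * t)"
        using listen_bits(2)[OF t] by (intro of_nat_mono) simp
      then show ?thesis using t by (intro divide_left_mono) auto
    qed
    \<comment> \<open>The constant 512 is 64 times 8: the 64 comes from the lower bound on the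
      listening probability, the 8 from the exponent of \<open>z\<close>.\<close>
    have p\<Delta>: "8 * c1 * x \<le> ?p * \<phi> * ?\<Delta>"
    proof -
      have "8 * c1 * x = 1 / (64 * real t) * \<phi> * (512 * c1 * (real t ^ 2 * ?lg / \<phi>))"
        using t \<phi> by (simp add: x_def field_simps power2_eq_square)
      also have "\<dots> \<le> ?p * \<phi> * ?\<Delta>"
        using p mind \<phi> c1 lg by (intro mult_mono) auto
      finally show ?thesis .
    qed
    have "?p * \<phi> * ?\<Delta> \<le> ?p * 1 * ?\<Delta>" using \<phi>1 by (intro mult_right_mono mult_left_mono) auto
    moreover have "8 * 2 * x \<le> 8 * c1 * x" using c1 x by (intro mult_right_mono) auto
    ultimately have p\<Delta>': "8 * x \<le> ?p * ?\<Delta> / 2" using p\<Delta> by simp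
    have ln: "ln (real (card V) + 1) \<le> ?p * ?\<Delta> / 2"
    proof -
      have "n * 2 \<le> n * n" using n by (intro mult_left_mono) auto
      then have "n + 1 \<le> n ^ 2" using n(2) unfolding power2_eq_square by linarith
      then have "real (n + 1) \<le> real (n ^ 2)" by (simp only: of_nat_le_iff)
      then have "ln (real n + 1) \<le> ln (real n ^ 2)" using n by (subst ln_le_cancel_iff) auto
      also have "\<dots> = 2 * ln (real n)" using n by (simp add: ln_realpow)
      also have "\<dots> \<le> 8 * x" using lnlg x by linarith
      finally show ?thesis using p\<Delta>' n by simp
    qed
    have zle: "z \<le> exp (- (c1 * x))" using p\<Delta> by (simp add: z_def)
    have nx: "real n = exp (ln (real n))" using n by simp
    have nz: "real (card V) * z \<le> 1"
    proof -
      have "real n * z \<le> exp (ln (real n)) * exp (- (c1 * x))"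
        using zle nx by (intro mult_mono) (auto simp: z_def)
      also have "\<dots> = exp (ln (real n) - c1 * x)" by (simp flip: exp_add)
      also have "\<dots> \<le> 1"
      proof -
        have "1 * x \<le> c1 * x" using c1 x by (intro mult_right_mono) auto
        then have "ln (real n) - c1 * x \<le> 0" using lnlg x by linarith
        then show ?thesis by simp
      qed
      finally show ?thesis using n by simp
    qed
    have slow: "4 * real ?L * real (card V) * z \<le> real n powr (- a) / 2"
    proof -
      have "real ?L \<le> b * exp x"
        using L(2) b exp_ge_add_one_self[of x] by (smt (verit) mult_left_mono)
      then have "4 * real ?L * real n * z \<le> 4 * (b * exp x) * exp (ln (real n)) * exp (- (c1 * x))"
        using zle nx b by (intro mult_mono) (auto simp: z_def)
      also have "\<dots> = 4 * b * exp (x + ln (real n) - c1 * x)"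
        by (simp add: exp_add exp_diff exp_minus divide_inverse)
      also have "\<dots> \<le> 4 * b * exp (- (8 * b) - a * ln (real n))"
      proof (intro mult_left_mono)
        have "8 * b * 1 \<le> 8 * b * x" using b x by (intro mult_left_mono) auto
        moreover have "a * ln (real n) \<le> a * x" using assms lnlg x by (intro mult_left_mono) auto
        ultimately have "x + ln (real n) - c1 * x \<le> - (8 * b) - a * ln (real n)"
          using lnlg x by (simp add: c1_def algebra_simps)
        then show "exp (x + ln (real n) - c1 * x) \<le> exp (- (8 * b) - a * ln (real n))" by simp
      qed (use b in simp)
      also have "\<dots> = 4 * b * exp (- (8 * b)) * real n powr (- a)"
        using n by (simp add: powr_def exp_diff exp_minus divide_inverse)
      also have "4 * b * exp (- (8 * b)) \<le> 1 / 2"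
      proof -
        have "8 * b \<le> exp (8 * b)" using exp_ge_add_one_self[of "8 * b"] by linarith
        then show ?thesis by (simp add: exp_minus field_simps)
      qed
      finally show ?thesis using n by (simp add: mult_right_mono)
    qed
    have cor: "real ((card E + 1) ^ t) * (1 / 2) ^ ?L \<le> real n powr (- a) / 2"
      using card_edges_le[OF graph] n L(1) assms t
      by (intro corruption_bound) (auto simp: x_def)
    have Kle: "ln (real (degree_sum E V)) < real K * \<phi> / 8"
    proof -
      have "8 * ln (real (degree_sum E V)) / \<phi> < real K" unfolding K_def by linarith
      then show ?thesis using \<phi> by (simp add: field_simps)
    qed
    have dsum: "1 \<le> degree_sum E V" "degree_sum E V \<le> n ^ 3"
    proof -
      have "1 \<le> card (incident E s)"
        using deg[OF s] finite_incident[OF fin(2), of s] by (simp add: Suc_le_eq card_gt_0_iff)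
      also have "\<dots> = degree_sum E {s}" by (simp add: degree_sum_def)
      also have "\<dots> \<le> degree_sum E V" using s fin(1) by (intro degree_sum_mono) auto
      finally show "1 \<le> degree_sum E V" .
      have "degree_sum E V \<le> 2 * vol E V" by (rule degree_sum_le_vol[OF graph]) simp
      also have "vol E V \<le> card E" unfolding vol_def using fin(2) by (intro card_mono) auto
      also have "card E \<le> n * n" using card_edges_le[OF graph] n by simp
      also have "2 * (n * n) \<le> n * (n * n)" using n by (intro mult_right_mono) auto
      finally show "degree_sum E V \<le> n ^ 3" by (simp add: power3_eq_cube mult.assoc)
    qed
    \<comment> \<open>A degree sum of at most \<open>n ^ 3\<close> gives
      \<open>K \<le> 24 * (?lg / \<phi>) + 1\<close>. Then \<open>2 * K + 1\<close> is at most
      \<open>48 * (?lg / \<phi>) + 3\<close>, and \<open>?lg / \<phi> \<ge> 1\<close> turns this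
      into 51.\<close>
    have K: "real (Suc (2 * K)) \<le> 51 * (?lg / \<phi>)"
    proof -
      have "real (degree_sum E V) \<le> real (n ^ 3)" using dsum(2) by (simp only: of_nat_le_iff)
      then have "ln (real (degree_sum E V)) \<le> ln (real n ^ 3)"
        using dsum(1) n by (subst ln_le_cancel_iff) auto
      also have "\<dots> = 3 * ln (real n)" using n by (simp add: ln_realpow)
      also have "\<dots> \<le> 3 * ?lg" using lnlg by simp
      finally have "8 * ln (real (degree_sum E V)) / \<phi> \<le> 8 * (3 * ?lg) / \<phi>"
        using \<phi> by (intro divide_right_mono mult_left_mono) auto
      moreover have "0 \<le> 8 * ln (real (degree_sum E V)) / \<phi>" using dsum(1) \<phi> by simp
      ultimately have "real K \<le> 24 * (?lg / \<phi>) + 1" unfolding K_def by simp linarith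
      moreover have "1 \<le> ?lg / \<phi>" using lg \<phi> \<phi>1 by (simp add: field_simps)
      ultimately show ?thesis by simp
    qed
    have T: "real (?L * Suc (2 * K)) \<le> 51 * b * (real t * ?lg ^ 2 / \<phi>)"
    proof -
      have "real (?L * Suc (2 * K)) \<le> b * x * (51 * (?lg / \<phi>))"
        unfolding of_nat_mult using L(2) K b x by (intro mult_mono) auto
      also have "\<dots> = 51 * b * (real t * ?lg ^ 2 / \<phi>)" by (simp add: x_def power2_eq_square)
      finally show ?thesis .
    qed
    show ?thesis
      using slow cor
      by (intro solves_broadcast_flood_protocol[where \<Delta> = ?\<Delta> and \<phi> = \<phi> and z = z and K = K])
        (use graph n s t L0 m0 \<Delta>0 \<Delta> ln ex \<phi> nz Kle T in \<open>auto simp: z_def\<close>)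
  qed
  show ?thesis
    \<comment> \<open>The witnesses depend only on \<open>\<kappa>\<close> and \<open>a\<close>, so
      one choice serves every \<open>C\<close>.\<close>
    by (intro exI[of _ "512 * c1"] conjI allI impI exI[of _ ?A] exI[of _ \<kappa>] exI[of _ "51 * b"])
      (use c1 main in auto)
qed

end
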